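(* Let $a>-1$ and $b>-1$ be real numbers, at least one of them being positive, and let $D=2+a+b$. Then for each $1\leq q<D$ there exists a constant $C$, depending only on $a$, $b$ and $q$, such that the following holds. Let $u$ be a nonnegative Lipschitz function with compact support in $\mathbb R^2$ such that $u\in C^1(\{u>0\})$ and $$u_\sigma\leq 0\quad\text{and}\quad u_\tau\leq 0\quad\text{in }(\mathbb R_+)^2,$$ with strict inequalities whenever $u>0$. Then $$\left(\int_{(\mathbb R_+)^2}\sigma^a\tau^b|u|^{q^*}\,d\sigma\,d\tau\right)^{1/q^*}\leq C\left(\int_{(\mathbb R_+)^2}\sigma^a\tau^b|\nabla u|^q\,d\sigma\,d\tau\right)^{1/q},$$ where $q^*=\frac{Dq}{D-q}$.
   Context: $(\mathbb R_+)^2=\{(\sigma,\tau)\in\mathbb R^2:\ \sigma>0,\ \tau>0\}$, and $u_\sigma,u_\tau$ denote the partial derivatives of $u=u(\sigma,\tau)$. *)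

theory Defs
  imports "HOL-Analysis.Analysis"
begin

definition pos_quadrant :: "(real \<times> real) set"
  where "pos_quadrant = {0<..} \<times> {0<..}"

text \<open>At points where the one-variable derivative does not exist, the values of
  \<open>d_sigma\<close> and \<open>d_tau\<close> are unspecified. For a Lipschitz function on the plane these points
  form a null set, which neither almost-everywhere statements nor integrals over the
  (complete) measure \<^const>\<open>lebesgue\<close> see.\<close>

definition d_sigma :: "(real \<times> real \<Rightarrow> real) \<Rightarrow> real \<times> real \<Rightarrow> real"
  where "d_sigma u x = deriv (\<lambda>s. u (s, snd x)) (fst x)"

definition d_tau :: "(real \<times> real \<Rightarrow> real) \<Rightarrow> real \<times> real \<Rightarrow> real"
  where "d_tau u x = deriv (\<lambda>t. u (fst x, t)) (snd x)"

definition grad :: "(real \<times> real \<Rightarrow> real) \<Rightarrow> real \<times> real \<Rightarrow> real \<times> real"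
  where "grad u x = (d_sigma u x, d_tau u x)"

text \<open>Meant for open \<open>S\<close>: derivatives are taken in the whole plane, not within \<open>S\<close>.\<close>

definition C1_on :: "(real \<times> real) set \<Rightarrow> (real \<times> real \<Rightarrow> real) \<Rightarrow> bool"
  where "C1_on S u \<longleftrightarrow>
    (\<forall>x\<in>S. (\<lambda>s. u (s, snd x)) field_differentiable at (fst x) \<and>
           (\<lambda>t. u (fst x, t)) field_differentiable at (snd x)) \<and>
    continuous_on S (grad u)"

definition compactly_supported :: "('a::topological_space \<Rightarrow> 'b::zero) \<Rightarrow> bool"
  where "compactly_supported u \<longleftrightarrow> compact (closure {x. u x \<noteq> 0})"

text \<open>The weak inequalities hold almost everywhere, since a Lipschitz function need not have
  partial derivatives everywhere. The strict ones are required at every point where \<open>u\<close> is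
  positive, where the derivatives exist by the \<open>C1_on\<close> assumption.\<close>

definition admissible :: "(real \<times> real \<Rightarrow> real) \<Rightarrow> bool"
  where "admissible u \<longleftrightarrow>
    (\<forall>x. 0 \<le> u x) \<and>
    (\<exists>L. L-lipschitz_on UNIV u) \<and>
    compactly_supported u \<and>
    C1_on {x. 0 < u x} u \<and>
    (AE x in lebesgue. x \<in> pos_quadrant \<longrightarrow> d_sigma u x \<le> 0 \<and> d_tau u x \<le> 0) \<and>
    (\<forall>x\<in>pos_quadrant. 0 < u x \<longrightarrow> d_sigma u x < 0 \<and> d_tau u x < 0)"

end

theory Submission
  imports Defs
begin

text \<open>
  The Sobolev inequality for functions that decrease in both variables is elementary. Write
  \<open>p = D - 1 = 1 + a + b\<close>. The case \<open>q = 1\<close> is proved for a nonnegative function \<open>v\<close> vanishing at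
  infinity; let \<open>K\<close> bound both \<open>\<integral> \<sigma>\<^sup>a \<tau>\<^sup>b \<bar>v\<^sub>\<sigma>\<bar>\<close> and \<open>\<integral> \<sigma>\<^sup>a \<tau>\<^sup>b \<bar>v\<^sub>\<tau>\<bar>\<close>, and by symmetry let \<open>a > 0\<close>.

  Integration by parts in \<open>\<sigma>\<close> has no boundary term, so that it gives the Hardy identity
  \<open>\<integral> \<sigma>\<^sup>a \<tau>\<^sup>b \<bar>v\<^sub>\<sigma>\<bar> = a \<integral> \<sigma>\<^bsup>a-1\<^esup> \<tau>\<^sup>b v\<close> (\<open>tail_density_hardy\<close>). As \<open>v\<close> is at least \<open>v (s, t)\<close> on the
  rectangle \<open>(0, s) \<times> (0, t)\<close>, the right-hand side controls \<open>v (s, t)\<close> pointwise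
  (\<open>decreasing_pointwise_bound\<close>), and for \<open>s \<le> t\<close> this reads \<open>v (s, t) s\<^sup>p \<le> const * K\<close>. For \<open>t < s\<close>
  there are two cases. If \<open>b > 0\<close>, exchanging the variables gives \<open>v (s, t) t\<^sup>p \<le> const * K\<close>. If
  \<open>b \<le> 0\<close>, then \<open>\<tau>\<^sup>b \<ge> \<sigma>\<^sup>b\<close> below the diagonal, so that \<open>\<integral> \<sigma>\<^sup>a \<tau>\<^sup>b \<bar>v\<^sub>\<tau>\<bar>\<close> and the values on the
  diagonal control \<open>\<integral> \<sigma>\<^bsup>a+b\<^esup> v (\<sigma>, t) d\<sigma>\<close> uniformly in \<open>t\<close>, and \<open>v (s, t) s\<^sup>p \<le> const * K\<close> holds
  everywhere (\<open>decreasing_bound_by_edge\<close>). In all cases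
  \<open>v\<^bsup>D/(D-1)\<^esup> = v v\<^bsup>1/p\<^esup> \<le> const * K\<^bsup>1/p\<^esup> (v / \<sigma> + v / \<tau>)\<close>, the term \<open>v / \<tau>\<close> being needed only when
  \<open>b > 0\<close>; integrating this and using the Hardy identity once more proves the case \<open>q = 1\<close>
  (\<open>sobolev_exponent_one\<close>).

  The general case follows from this one for \<open>v = u\<^sup>k\<close>, \<open>k = q (D - 1) / (D - q)\<close>, and from
  Hoelder's inequality. An admissible \<open>u\<close> is strictly decreasing along each line where it is
  positive, so that it satisfies the fundamental theorem of calculus up to its first zero,
  and its gradient vanishes almost everywhere on \<open>{u = 0}\<close> (\<open>AE_grad_eq_pos_grad\<close>).

  The weighted integrals are kept as extended nonnegative numbers until the last step, so that Tonelli's theorem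
  applies without integrability conditions.
\<close>

section \<open>Weighted integrals over the quadrant\<close>

text \<open>The power \<open>x\<^sup>a\<close> extended by zero to the left half-line. Weights built from it restrict
  integrals over the plane to the quadrant.\<close>

definition pw :: "real \<Rightarrow> real \<Rightarrow> real"
  where "pw a x = (if 0 < x then x powr a else 0)"

text \<open>The integral of \<open>s\<^sup>a t\<^sup>b f s t\<close> over the quadrant, for \<open>f\<close> nonnegative there. Functions of two
  variables are curried, so that exchanging the variables is an operation on terms.\<close>

definition quad_int :: "real \<Rightarrow> real \<Rightarrow> (real \<Rightarrow> real \<Rightarrow> real) \<Rightarrow> ennreal"
  where "quad_int a b f =
    (\<integral>\<^sup>+t. (\<integral>\<^sup>+s. ennreal (pw a s * pw b t * f s t) \<partial>lborel) \<partial>lborel)"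

text \<open>On the quadrant, \<open>v\<close> is decreasing in the first variable with \<open>-v\<^sub>s = g\<close> and tends to zero as
  \<open>s\<close> tends to infinity; this is expressed by \<open>v s t\<close> being the integral of \<open>g\<close> over the half-line
  beyond \<open>s\<close>. The second variable is treated by applying this to the flipped functions.\<close>

definition tail_density :: "(real \<Rightarrow> real \<Rightarrow> real) \<Rightarrow> (real \<Rightarrow> real \<Rightarrow> real) \<Rightarrow> bool"
  where "tail_density v g \<longleftrightarrow>
    (\<lambda>(s, t). v s t) \<in> borel_measurable (lborel \<Otimes>\<^sub>M lborel) \<and>
    (\<lambda>(s, t). g s t) \<in> borel_measurable (lborel \<Otimes>\<^sub>M lborel) \<and>
    (\<forall>s t. 0 \<le> v s t) \<and> (\<forall>s t. 0 \<le> g s t) \<and>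
    (\<forall>s>0. \<forall>t>0. ennreal (v s t) = (\<integral>\<^sup>+x. ennreal (g x t) * indicator {s<..} x \<partial>lborel))"

lemma pw_nonneg [simp]: "0 \<le> pw a x"
  by (simp add: pw_def)

lemma pw_pos: "0 < x \<Longrightarrow> pw a x = x powr a"
  by (simp add: pw_def)

lemma pw_nonpos [simp]: "x \<le> 0 \<Longrightarrow> pw a x = 0"
  by (simp add: pw_def)

lemma measurable_pw [measurable]: "pw a \<in> borel_measurable borel"
  unfolding pw_def by measurable

lemma nn_integral_pw:
  assumes "-1 < p" "0 < c"
  shows "(\<integral>\<^sup>+x. ennreal (pw p x) * indicator {..<c} x \<partial>lborel) = ennreal (c powr (p + 1) / (p + 1))"
proof -
  have "((\<lambda>x. x powr p) has_integral (c powr (p+1) / (p+1))) {0..c}"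
    using assms by (intro has_integral_powr_from_0) auto
  then have "(\<integral>\<^sup>+x. ennreal (x powr p) * indicator {0..c} x \<partial>lborel) = ennreal (c powr (p + 1) / (p + 1))"
    by (intro nn_integral_has_integral_lebesgue') auto
  \<comment> \<open>both integrands vanish at \<open>0\<close> and differ only at \<open>c\<close>\<close>
  moreover have "AE x in lborel. x \<noteq> c"
    by (rule AE_lborel_singleton)
  then have "(\<integral>\<^sup>+x. ennreal (pw p x) * indicator {..<c} x \<partial>lborel)
      = (\<integral>\<^sup>+x. ennreal (x powr p) * indicator {0..c} x \<partial>lborel)"
    by (intro nn_integral_cong_AE, eventually_elim) (simp add: pw_def indicator_def)
  ultimately show ?thesis by simp
qed

lemma quad_int_commute:
  assumes "(\<lambda>(s, t). f s t) \<in> borel_measurable (lborel \<Otimes>\<^sub>M lborel)"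
  shows "quad_int a b f = quad_int b a (\<lambda>s t. f t s)"
proof -
  have [measurable]: "case_prod f \<in> borel_measurable (lborel \<Otimes>\<^sub>M lborel)"
    using assms by simp
  have "quad_int a b f =
      (\<integral>\<^sup>+s. (\<integral>\<^sup>+t. ennreal (pw a s * pw b t * f s t) \<partial>lborel) \<partial>lborel)"
    unfolding quad_int_def
    by (rule lborel_pair.Fubini'[of "\<lambda>s t. ennreal (pw a s * pw b t * f s t)"]) measurable
  then show ?thesis
    by (simp add: quad_int_def mult_ac)
qed

lemma quad_int_mono:
  assumes "\<And>s t. 0 < s \<Longrightarrow> 0 < t \<Longrightarrow> pw a s * pw b t * f s t \<le> pw a' s * pw b' t * g s t"
  shows "quad_int a b f \<le> quad_int a' b' g"
  unfolding quad_int_def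
proof (intro nn_integral_mono)
  fix s t :: real
  show "ennreal (pw a s * pw b t * f s t) \<le> ennreal (pw a' s * pw b' t * g s t)"
    using assms[of s t] by (cases "s > 0"; cases "t > 0") (auto intro: ennreal_leI)
qed

lemma nn_integral_pull_weight:
  assumes [measurable]: "f \<in> borel_measurable lborel"
  shows "(\<integral>\<^sup>+s. ennreal (pw a s * pw b t * f s) \<partial>lborel) = ennreal (pw b t) * (\<integral>\<^sup>+s. ennreal (pw a s * f s) \<partial>lborel)"
proof -
  have "(\<integral>\<^sup>+s. ennreal (pw a s * pw b t * f s) \<partial>lborel) = (\<integral>\<^sup>+s. ennreal (pw b t) * ennreal (pw a s * f s) \<partial>lborel)"
    by (intro nn_integral_cong) (simp add: mult_ac flip: ennreal_mult')
  then show ?thesis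
    by (simp add: nn_integral_cmult)
qed

lemma quad_int_divide_fst: "quad_int a b (\<lambda>s t. f s t / s) = quad_int (a - 1) b f"
  unfolding quad_int_def
  by (intro nn_integral_cong arg_cong[of _ _ ennreal]) (auto simp: pw_def powr_diff)

lemma quad_int_divide_snd: "quad_int a b (\<lambda>s t. f s t / t) = quad_int a (b - 1) f"
  unfolding quad_int_def
  by (intro nn_integral_cong arg_cong[of _ _ ennreal]) (auto simp: pw_def powr_diff)

lemma quad_int_cmult:
  assumes [measurable]: "(\<lambda>(s, t). f s t) \<in> borel_measurable (lborel \<Otimes>\<^sub>M lborel)" and "0 \<le> c"
  shows "quad_int a b (\<lambda>s t. c * f s t) = ennreal c * quad_int a b f"
proof -
  have "quad_int a b (\<lambda>s t. c * f s t)
    = (\<integral>\<^sup>+t. (\<integral>\<^sup>+s. ennreal c * ennreal (pw a s * pw b t * f s t) \<partial>lborel) \<partial>lborel)"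
    unfolding quad_int_def using assms(2)
    by (intro nn_integral_cong) (simp add: mult_ac flip: ennreal_mult')
  then show ?thesis
    unfolding quad_int_def by (simp add: nn_integral_cmult)
qed

lemma quad_int_add:
  assumes [measurable]: "(\<lambda>(s, t). f s t) \<in> borel_measurable (lborel \<Otimes>\<^sub>M lborel)"
    "(\<lambda>(s, t). g s t) \<in> borel_measurable (lborel \<Otimes>\<^sub>M lborel)"
    and nn: "\<And>s t. 0 < s \<Longrightarrow> 0 < t \<Longrightarrow> 0 \<le> f s t" "\<And>s t. 0 < s \<Longrightarrow> 0 < t \<Longrightarrow> 0 \<le> g s t"
  shows "quad_int a b (\<lambda>s t. f s t + g s t) = quad_int a b f + quad_int a b g"
proof -
  have "ennreal (pw a s * pw b t * (f s t + g s t))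
      = ennreal (pw a s * pw b t * f s t) + ennreal (pw a s * pw b t * g s t)" for s t
    using nn[of s t] by (cases "0 < s \<and> 0 < t") (auto simp: distrib_left)
  then show ?thesis
    unfolding quad_int_def by (simp add: nn_integral_add)
qed

lemma quad_int_Holder:
  assumes m: "(\<lambda>(s, t). f s t) \<in> borel_measurable (lborel \<Otimes>\<^sub>M lborel)"
    "(\<lambda>(s, t). g s t) \<in> borel_measurable (lborel \<Otimes>\<^sub>M lborel)"
    and nn: "\<And>s t. 0 \<le> f s t" "\<And>s t. 0 \<le> g s t"
    and pq: "1 < p" "1 < q" "1 / p + 1 / q = 1"
    and X: "0 < X" "quad_int a b (\<lambda>s t. f s t powr p) \<le> ennreal X"
    and Y: "0 < Y" "quad_int a b (\<lambda>s t. g s t powr q) \<le> ennreal Y"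
  shows "quad_int a b (\<lambda>s t. f s t * g s t) \<le> ennreal (X powr (1 / p) * Y powr (1 / q))"
proof -
  note [measurable] = m
  define c where "c = X powr (1 / p) * Y powr (1 / q)"
  have c: "0 < c" using X Y by (simp add: c_def)
  \<comment> \<open>Young's inequality for \<open>f\<close> and \<open>g\<close> divided by the bounds of their norms\<close>
  have "f s t * g s t \<le> c / (p * X) * f s t powr p + c / (q * Y) * g s t powr q" for s t
  proof -
    have "f s t * g s t = c * ((f s t / X powr (1 / p)) * (g s t / Y powr (1 / q)))"
      using X Y by (simp add: c_def)
    also have "\<dots> \<le> c * ((f s t / X powr (1 / p)) powr p / p + (g s t / Y powr (1 / q)) powr q / q)"
      using c pq nn by (intro mult_left_mono Youngs_inequality) auto
    also have "\<dots> = c / (p * X) * f s t powr p + c / (q * Y) * g s t powr q"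
      using X Y nn pq by (simp add: powr_divide powr_powr distrib_left mult_ac)
    finally show ?thesis .
  qed
  then have "quad_int a b (\<lambda>s t. f s t * g s t)
      \<le> quad_int a b (\<lambda>s t. c / (p * X) * f s t powr p + c / (q * Y) * g s t powr q)"
    by (intro quad_int_mono mult_left_mono) auto
  also have "\<dots> = ennreal (c / (p * X)) * quad_int a b (\<lambda>s t. f s t powr p)
      + ennreal (c / (q * Y)) * quad_int a b (\<lambda>s t. g s t powr q)"
    using c pq X Y by (simp add: quad_int_add quad_int_cmult del: times_divide_eq_left)
  also have "\<dots> \<le> ennreal (c / (p * X)) * ennreal X + ennreal (c / (q * Y)) * ennreal Y"
    by (intro add_mono mult_left_mono X Y) auto
  also have "\<dots> = ennreal (c / p + c / q)"
    using X Y c pq by (simp flip: ennreal_mult ennreal_plus)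
  also have "c / p + c / q = c * (1 / p + 1 / q)"
    by (simp add: distrib_left)
  finally show ?thesis by (simp only: pq mult_1_right c_def)
qed

lemma quad_int_finite:
  assumes ab: "-1 < a" "-1 < b" and R: "0 < R" and M: "0 \<le> M"
    and bound: "\<And>s t. 0 < s \<Longrightarrow> 0 < t \<Longrightarrow> f s t \<le> M"
    and zero: "\<And>s t. R \<le> s \<or> R \<le> t \<Longrightarrow> f s t = 0"
  shows "quad_int a b f < \<infinity>"
proof -
  have "quad_int a b f \<le> (\<integral>\<^sup>+t. (\<integral>\<^sup>+s. ennreal M * (ennreal (pw b t) * indicator {..<R} t) *
      (ennreal (pw a s) * indicator {..<R} s) \<partial>lborel) \<partial>lborel)"
    unfolding quad_int_def
  proof (intro nn_integral_mono)
    fix s t :: real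
    show "ennreal (pw a s * pw b t * f s t) \<le> ennreal M * (ennreal (pw b t) * indicator {..<R} t) *
      (ennreal (pw a s) * indicator {..<R} s)"
    proof (cases "0 < s \<and> 0 < t \<and> s < R \<and> t < R")
      case True
      then have "pw a s * pw b t * f s t \<le> pw a s * pw b t * M"
        using bound by (intro mult_left_mono) auto
      then show ?thesis
        using True M by (simp add: ennreal_leI mult_ac flip: ennreal_mult)
    qed (use zero[of s t] in \<open>auto simp: pw_def\<close>)
  qed
  also have "\<dots> = (\<integral>\<^sup>+t. ennreal M * (ennreal (pw b t) * indicator {..<R} t) * ennreal (R powr (a + 1) / (a + 1)) \<partial>lborel)"
    by (intro nn_integral_cong, subst nn_integral_cmult) (auto simp: nn_integral_pw[OF ab(1) R])
  also have "\<dots> = ennreal M * ennreal (R powr (b + 1) / (b + 1)) * ennreal (R powr (a + 1) / (a + 1))"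
    by (subst nn_integral_multc, simp, subst nn_integral_cmult) (auto simp: nn_integral_pw[OF ab(2) R])
  also have "\<dots> < \<infinity>"
    by (simp add: ennreal_mult_less_top)
  finally show ?thesis .
qed

section \<open>The Hardy identity and pointwise bounds\<close>

lemma tail_density_decreasing:
  assumes "tail_density v g" "0 < s" "s \<le> s'" "0 < t"
  shows "v s' t \<le> v s t"
proof -
  have "ennreal (v s' t) = (\<integral>\<^sup>+x. ennreal (g x t) * indicator {s'<..} x \<partial>lborel)"
    "ennreal (v s t) = (\<integral>\<^sup>+x. ennreal (g x t) * indicator {s<..} x \<partial>lborel)"
    using assms by (auto simp: tail_density_def)
  moreover have "(\<integral>\<^sup>+x. ennreal (g x t) * indicator {s'<..} x \<partial>lborel)
    \<le> (\<integral>\<^sup>+x. ennreal (g x t) * indicator {s<..} x \<partial>lborel)"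
    using assms by (intro nn_integral_mono) (auto simp: indicator_def)
  ultimately show ?thesis
    using assms by (metis ennreal_le_iff tail_density_def)
qed

text \<open>Writing \<open>x\<^sup>a\<close> as the integral of \<open>a r\<^bsup>a-1\<^esup>\<close> over \<open>0 < r < x\<close> turns integration by parts into
  an exchange of integrals.\<close>

lemma tail_density_hardy_1d:
  assumes v: "tail_density v g" and a: "0 < a" and t: "0 < t"
  shows "(\<integral>\<^sup>+x. ennreal (pw a x * g x t) \<partial>lborel)
    = ennreal a * (\<integral>\<^sup>+r. ennreal (pw (a - 1) r * v r t) \<partial>lborel)"
proof -
  have [measurable]: "case_prod g \<in> borel_measurable (lborel \<Otimes>\<^sub>M lborel)"
    "case_prod v \<in> borel_measurable (lborel \<Otimes>\<^sub>M lborel)"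
    and nn: "\<And>s t. 0 \<le> v s t" "\<And>s t. 0 \<le> g s t"
    using v by (auto simp: tail_density_def)
  have gt [measurable]: "(\<lambda>x. g x t) \<in> borel_measurable borel"
    by measurable
  have "ennreal (pw a x * g x t)
      = (\<integral>\<^sup>+r. ennreal a * ennreal (pw (a - 1) r) * ennreal (g x t) * indicator {r<..} x \<partial>lborel)"
    for x
  proof (cases "x > 0")
    case True
    have "(\<integral>\<^sup>+r. ennreal a * ennreal (pw (a - 1) r) * ennreal (g x t) * indicator {r<..} x \<partial>lborel)
       = (\<integral>\<^sup>+r. (ennreal a * ennreal (g x t)) * (ennreal (pw (a - 1) r) * indicator {..<x} r) \<partial>lborel)"
      by (intro nn_integral_cong) (auto simp: indicator_def mult_ac)
    also have "\<dots> = (ennreal a * ennreal (g x t)) * ennreal (x powr a / a)"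
      using nn_integral_pw[of "a - 1" x] True a by (subst nn_integral_cmult) auto
    also have "\<dots> = ennreal (pw a x * g x t)"
      using a True nn by (simp add: pw_pos flip: ennreal_mult)
    finally show ?thesis by simp
  next
    case False
    then have "(\<integral>\<^sup>+r. ennreal a * ennreal (pw (a - 1) r) * ennreal (g x t) * indicator {r<..} x \<partial>lborel)
      = (\<integral>\<^sup>+(r::real). 0 \<partial>lborel)"
      by (intro nn_integral_cong) (auto simp: indicator_def pw_def)
    with False show ?thesis by simp
  qed
  then have "(\<integral>\<^sup>+x. ennreal (pw a x * g x t) \<partial>lborel)
    = (\<integral>\<^sup>+x. (\<integral>\<^sup>+r. ennreal a * ennreal (pw (a - 1) r) * ennreal (g x t) * indicator {r<..} x \<partial>lborel) \<partial>lborel)"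
    by simp
  also have "\<dots> = (\<integral>\<^sup>+r. (\<integral>\<^sup>+x. ennreal a * ennreal (pw (a - 1) r) * ennreal (g x t) * indicator {r<..} x \<partial>lborel) \<partial>lborel)"
    unfolding greaterThan_def indicator_def mem_Collect_eq
    by (rule lborel_pair.Fubini') measurable
  also have "\<dots> = (\<integral>\<^sup>+r. ennreal a * ennreal (pw (a - 1) r * v r t) \<partial>lborel)"
  proof (intro nn_integral_cong)
    fix r :: real
    show "(\<integral>\<^sup>+x. ennreal a * ennreal (pw (a - 1) r) * ennreal (g x t) * indicator {r<..} x \<partial>lborel)
       = ennreal a * ennreal (pw (a - 1) r * v r t)"
    proof (cases "r > 0")
      case True
      then have "ennreal (v r t) = (\<integral>\<^sup>+x. ennreal (g x t) * indicator {r<..} x \<partial>lborel)"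
        using v t by (auto simp: tail_density_def)
      then show ?thesis
        using nn by (simp add: mult.assoc nn_integral_cmult ennreal_mult)
    qed auto
  qed
  also have "\<dots> = ennreal a * (\<integral>\<^sup>+r. ennreal (pw (a - 1) r * v r t) \<partial>lborel)"
    by (rule nn_integral_cmult) measurable
  finally show ?thesis .
qed

lemma tail_density_hardy:
  assumes v: "tail_density v g" and a: "0 < a"
  shows "quad_int a b g = ennreal a * quad_int (a - 1) b v"
proof -
  have [measurable]: "case_prod g \<in> borel_measurable (lborel \<Otimes>\<^sub>M lborel)"
    "case_prod v \<in> borel_measurable (lborel \<Otimes>\<^sub>M lborel)"
    using v by (auto simp: tail_density_def)
  have "quad_int a b g = (\<integral>\<^sup>+t. ennreal (pw b t) * (\<integral>\<^sup>+s. ennreal (pw a s * g s t) \<partial>lborel) \<partial>lborel)"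
    unfolding quad_int_def by (intro nn_integral_cong nn_integral_pull_weight) measurable
  also have "\<dots> = (\<integral>\<^sup>+t. ennreal a * (\<integral>\<^sup>+s. ennreal (pw (a - 1) s * pw b t * v s t) \<partial>lborel) \<partial>lborel)"
  proof (intro nn_integral_cong)
    fix t :: real
    have "(\<integral>\<^sup>+s. ennreal (pw (a - 1) s * pw b t * v s t) \<partial>lborel)
      = ennreal (pw b t) * (\<integral>\<^sup>+s. ennreal (pw (a - 1) s * v s t) \<partial>lborel)"
      by (intro nn_integral_pull_weight) measurable
    then show "ennreal (pw b t) * (\<integral>\<^sup>+s. ennreal (pw a s * g s t) \<partial>lborel)
      = ennreal a * (\<integral>\<^sup>+s. ennreal (pw (a - 1) s * pw b t * v s t) \<partial>lborel)"
      using tail_density_hardy_1d[OF v a, of t] by (cases "t > 0") (simp_all add: mult_ac)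
  qed
  also have "\<dots> = ennreal a * quad_int (a - 1) b v"
    unfolding quad_int_def by (rule nn_integral_cmult) measurable
  finally show ?thesis .
qed

lemma decreasing_pointwise_bound:
  assumes dec1: "\<And>s s' t. 0 < s \<Longrightarrow> s \<le> s' \<Longrightarrow> 0 < t \<Longrightarrow> v s' t \<le> v s t"
    and dec2: "\<And>s t t'. 0 < s \<Longrightarrow> 0 < t \<Longrightarrow> t \<le> t' \<Longrightarrow> v s t' \<le> v s t"
    and nn: "\<And>s t. 0 \<le> v s t"
    and a: "0 < a" and b: "-1 < b" and H: "ennreal a * quad_int (a - 1) b v \<le> ennreal K" and K: "0 \<le> K"
    and s: "0 < s" and t: "0 < t"
  shows "v s t * s powr a * t powr (b + 1) \<le> (b + 1) * K"
proof -
  have "ennreal (v s t * (s powr a / a) * (t powr (b + 1) / (b + 1)))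
      = (\<integral>\<^sup>+y. ennreal (v s t * (s powr a / a)) * (ennreal (pw b y) * indicator {..<t} y) \<partial>lborel)"
    using nn_integral_pw[of b t] a b s t nn by (simp add: nn_integral_cmult flip: ennreal_mult)
  also have "\<dots> = (\<integral>\<^sup>+y. (\<integral>\<^sup>+x. ennreal (v s t) * (ennreal (pw b y) * indicator {..<t} y) *
      (ennreal (pw (a - 1) x) * indicator {..<s} x) \<partial>lborel) \<partial>lborel)"
  proof (intro nn_integral_cong)
    fix y :: real
    have "(\<integral>\<^sup>+x. ennreal (v s t) * (ennreal (pw b y) * indicator {..<t} y) *
      (ennreal (pw (a - 1) x) * indicator {..<s} x) \<partial>lborel) =
      ennreal (v s t) * (ennreal (pw b y) * indicator {..<t} y) * ennreal (s powr a / a)"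
      using nn_integral_pw[of "a - 1" s] a s by (subst nn_integral_cmult) auto
    moreover have "ennreal (v s t * (s powr a / a)) = ennreal (v s t) * ennreal (s powr a / a)"
      using nn a by (intro ennreal_mult) auto
    ultimately show "ennreal (v s t * (s powr a / a)) * (ennreal (pw b y) * indicator {..<t} y) =
      (\<integral>\<^sup>+x. ennreal (v s t) * (ennreal (pw b y) * indicator {..<t} y) *
      (ennreal (pw (a - 1) x) * indicator {..<s} x) \<partial>lborel)"
      by (simp only: mult_ac)
  qed
  also have "\<dots> \<le> quad_int (a - 1) b v"
    unfolding quad_int_def
  proof (intro nn_integral_mono)
    fix x y :: real
    show "ennreal (v s t) * (ennreal (pw b y) * indicator {..<t} y) *
      (ennreal (pw (a - 1) x) * indicator {..<s} x) \<le> ennreal (pw (a - 1) x * pw b y * v x y)"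
    proof (cases "0 < x \<and> x < s \<and> 0 < y \<and> y < t")
      case True
      then have "v s t \<le> v x y"
        using dec1[of x s t] dec2[of x y t] s t by auto
      then have "v s t * pw b y * pw (a - 1) x \<le> pw (a - 1) x * pw b y * v x y"
        by (simp add: mult_ac mult_left_mono mult_right_mono)
      then show ?thesis
        using True nn by (simp add: ennreal_leI flip: ennreal_mult)
    qed (auto simp: indicator_def pw_def)
  qed
  finally have "ennreal a * ennreal (v s t * (s powr a / a) * (t powr (b + 1) / (b + 1))) \<le> ennreal K"
    using H by (meson mult_left_mono order_trans zero_le)
  then have "a * (v s t * (s powr a / a) * (t powr (b + 1) / (b + 1))) \<le> K"
    using a b nn K by (simp flip: ennreal_mult)
  also have "a * (v s t * (s powr a / a) * (t powr (b + 1) / (b + 1)))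
      = v s t * s powr a * t powr (b + 1) / (b + 1)"
    using a by simp
  finally show ?thesis
    using b by (simp add: pos_divide_le_eq mult.commute)
qed

text \<open>For \<open>b \<le> 0\<close> the integrals over horizontal lines \<open>\<integral> x\<^bsup>a+b\<^esup> v x t dx\<close> are bounded uniformly in
  \<open>t\<close>: by \<open>edge\<close> in terms of \<open>h = -v\<^sub>t\<close> and of the diagonal values of \<open>v\<close>, and by \<open>diag\<close> the diagonal
  values in terms of the integral of \<open>v\<close> below the diagonal.\<close>

lemma decreasing_bound_by_edge:
  assumes dec1: "\<And>s s' t. 0 < s \<Longrightarrow> s \<le> s' \<Longrightarrow> 0 < t \<Longrightarrow> v s' t \<le> v s t"
    and w: "tail_density (\<lambda>t s. v s t) (\<lambda>t s. h s t)"
    and a: "0 < a" and b: "-1 < b" "b \<le> 0" and K: "0 \<le> K"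
    and H: "ennreal a * quad_int (a - 1) b v \<le> ennreal K"
    and B: "quad_int a b h \<le> ennreal K"
    and s: "0 < s" and t: "0 < t"
  shows "v s t * s powr (a + b + 1) \<le> (a + b + 1) * (1 + (b + 1) / a) * K"
proof -
  have m: "(\<lambda>(s, t). v s t) \<in> borel_measurable (lborel \<Otimes>\<^sub>M lborel)"
    "(\<lambda>(s, t). h s t) \<in> borel_measurable (lborel \<Otimes>\<^sub>M lborel)"
    and nn: "\<And>s t. 0 \<le> v s t" "\<And>s t. 0 \<le> h s t"
    using w measurable_pair_swap[of "\<lambda>(t, s). v s t" lborel lborel borel]
      measurable_pair_swap[of "\<lambda>(t, s). h s t" lborel lborel borel]
    by (auto simp: tail_density_def case_prod_unfold)
  note [measurable] = m
  have dec2: "v s t' \<le> v s t" if "0 < s" "0 < t" "t \<le> t'" for s t t'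
    using tail_density_decreasing[OF w] that by simp
  have diag: "ennreal (pw (a + b) x * v x x)
      \<le> ennreal (b + 1) * (\<integral>\<^sup>+y. ennreal (pw b y * pw (a - 1) x * v x y) \<partial>lborel)"
    if x: "0 < x" for x
  proof -
    have "pw (a + b) x * v x x = (b + 1) * (x powr (a - 1) * v x x * (x powr (b + 1) / (b + 1)))"
      using b x by (simp add: pw_pos flip: powr_add)
    then have "ennreal (pw (a + b) x * v x x)
        = ennreal (b + 1) * (ennreal (x powr (a - 1) * v x x) * ennreal (x powr (b + 1) / (b + 1)))"
      using b nn by (simp flip: ennreal_mult)
    also have "ennreal (x powr (a - 1) * v x x) * ennreal (x powr (b + 1) / (b + 1)) =
        (\<integral>\<^sup>+y. ennreal (x powr (a - 1) * v x x) * (ennreal (pw b y) * indicator {..<x} y) \<partial>lborel)"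
      using nn_integral_pw[of b x] b x by (simp add: nn_integral_cmult)
    also have "\<dots> \<le> (\<integral>\<^sup>+y. ennreal (pw b y * pw (a - 1) x * v x y) \<partial>lborel)"
    proof (intro nn_integral_mono)
      fix y :: real
      show "ennreal (x powr (a - 1) * v x x) * (ennreal (pw b y) * indicator {..<x} y)
        \<le> ennreal (pw b y * pw (a - 1) x * v x y)"
      proof (cases "0 < y \<and> y < x")
        case True
        then have "x powr (a - 1) * v x x * pw b y \<le> pw b y * pw (a - 1) x * v x y"
          using dec2[of x y x] x by (simp add: pw_pos mult_ac mult_left_mono)
        then show ?thesis
          using True nn by (simp add: ennreal_leI flip: ennreal_mult)
      qed (auto simp: indicator_def pw_def)
    qed
    finally show ?thesis by (simp add: mult_left_mono)
  qed
  have edge: "ennreal (pw (a + b) x * v x t)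
      \<le> (\<integral>\<^sup>+y. ennreal (pw b y * pw a x * h x y) \<partial>lborel) + ennreal (pw (a + b) x * v x x)"
    if x: "0 < x" for x
  proof (cases "t < x")
    case False
    then have "v x t \<le> v x x"
      using dec2[of x x t] x by simp
    then have "ennreal (pw (a + b) x * v x t) \<le> ennreal (pw (a + b) x * v x x)"
      by (intro ennreal_leI mult_left_mono) auto
    then show ?thesis
      by (rule add_increasing[OF zero_le])
  next
    case True
    have "ennreal (v x t) = (\<integral>\<^sup>+y. ennreal (h x y) * indicator {t<..} y \<partial>lborel)"
      using w x t by (auto simp: tail_density_def)
    also have "\<dots> = (\<integral>\<^sup>+y. ennreal (h x y) * indicator {t<..x} y + ennreal (h x y) * indicator {x<..} y \<partial>lborel)"
      using True by (intro nn_integral_cong) (auto simp: indicator_def)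
    also have "\<dots> = (\<integral>\<^sup>+y. ennreal (h x y) * indicator {t<..x} y \<partial>lborel)
        + (\<integral>\<^sup>+y. ennreal (h x y) * indicator {x<..} y \<partial>lborel)"
      by (rule nn_integral_add) measurable
    also have "(\<integral>\<^sup>+y. ennreal (h x y) * indicator {x<..} y \<partial>lborel) = ennreal (v x x)"
      using w x by (auto simp: tail_density_def)
    finally have "ennreal (pw (a + b) x * v x t) = ennreal (pw (a + b) x) *
        (\<integral>\<^sup>+y. ennreal (h x y) * indicator {t<..x} y \<partial>lborel) + ennreal (pw (a + b) x * v x x)"
      using nn by (simp add: ennreal_mult distrib_left)
    also have "ennreal (pw (a + b) x) * (\<integral>\<^sup>+y. ennreal (h x y) * indicator {t<..x} y \<partial>lborel)
        = (\<integral>\<^sup>+y. ennreal (pw (a + b) x) * (ennreal (h x y) * indicator {t<..x} y) \<partial>lborel)"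
      by (rule nn_integral_cmult[symmetric]) measurable
    also have "\<dots> \<le> (\<integral>\<^sup>+y. ennreal (pw b y * pw a x * h x y) \<partial>lborel)"
    proof (intro nn_integral_mono)
      fix y :: real
      show "ennreal (pw (a + b) x) * (ennreal (h x y) * indicator {t<..x} y)
          \<le> ennreal (pw b y * pw a x * h x y)"
      proof (cases "t < y \<and> y \<le> x")
        case True
        then have "x powr b \<le> y powr b"
          \<comment> \<open>the only step that needs \<open>b \<le> 0\<close>\<close>
          using t b by (intro powr_mono2') auto
        then have "pw (a + b) x * h x y \<le> pw b y * pw a x * h x y"
          using True t x nn by (intro mult_right_mono) (auto simp: pw_pos powr_add mult_ac mult_left_mono)
        then show ?thesis
          using True nn by (simp add: ennreal_leI flip: ennreal_mult)
      qed auto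
    qed
    finally show ?thesis by (simp add: add_right_mono)
  qed
  have "ennreal (v s t * (s powr (a + b + 1) / (a + b + 1)))
      = (\<integral>\<^sup>+x. ennreal (v s t) * (ennreal (pw (a + b) x) * indicator {..<s} x) \<partial>lborel)"
    using nn_integral_pw[of "a + b" s] a b s nn by (simp add: nn_integral_cmult flip: ennreal_mult)
  also have "\<dots> \<le> (\<integral>\<^sup>+x. (\<integral>\<^sup>+y. ennreal (pw b y * pw a x * h x y) \<partial>lborel) +
       ennreal (b + 1) * (\<integral>\<^sup>+y. ennreal (pw b y * pw (a - 1) x * v x y) \<partial>lborel) \<partial>lborel)"
  proof (intro nn_integral_mono)
    fix x :: real
    show "ennreal (v s t) * (ennreal (pw (a + b) x) * indicator {..<s} x)
      \<le> (\<integral>\<^sup>+y. ennreal (pw b y * pw a x * h x y) \<partial>lborel) +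
       ennreal (b + 1) * (\<integral>\<^sup>+y. ennreal (pw b y * pw (a - 1) x * v x y) \<partial>lborel)"
    proof (cases "0 < x \<and> x < s")
      case True
      then have "v s t \<le> v x t"
        using dec1[of x s t] t by simp
      then have "v s t * pw (a + b) x \<le> pw (a + b) x * v x t"
        by (subst mult.commute) (rule mult_left_mono, simp_all)
      then have "ennreal (v s t) * (ennreal (pw (a + b) x) * indicator {..<s} x)
          \<le> ennreal (pw (a + b) x * v x t)"
        using True nn by (simp add: ennreal_leI flip: ennreal_mult)
      then show ?thesis
        using edge[of x] diag[of x] True
        by (meson add_left_mono order_trans)
    qed (auto simp: indicator_def pw_def)
  qed
  also have "\<dots> = quad_int b a (\<lambda>y x. h x y) + ennreal (b + 1) * quad_int b (a - 1) (\<lambda>y x. v x y)"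
    unfolding quad_int_def by (subst nn_integral_add) (auto simp: nn_integral_cmult)
  also have "\<dots> = quad_int a b h + ennreal (b + 1) * quad_int (a - 1) b v"
    by (simp only: quad_int_commute[OF m(1), of "a - 1" b] quad_int_commute[OF m(2), of a b])
  finally have "ennreal a * ennreal (v s t * (s powr (a + b + 1) / (a + b + 1)))
      \<le> ennreal a * (quad_int a b h + ennreal (b + 1) * quad_int (a - 1) b v)"
    by (rule mult_left_mono) simp
  also have "\<dots> = ennreal a * quad_int a b h + ennreal (b + 1) * (ennreal a * quad_int (a - 1) b v)"
    by (simp add: distrib_left mult_ac)
  also have "\<dots> \<le> ennreal a * ennreal K + ennreal (b + 1) * ennreal K"
    by (intro add_mono mult_left_mono B H) auto
  also have "\<dots> = ennreal (a * K + (b + 1) * K)"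
    using a b K by (simp flip: ennreal_mult ennreal_plus)
  finally have "a * (v s t * (s powr (a + b + 1) / (a + b + 1))) \<le> a * K + (b + 1) * K"
    using a b K nn by (simp del: ennreal_plus flip: ennreal_mult)
  then have "(a + b + 1) / a * (a * (v s t * (s powr (a + b + 1) / (a + b + 1))))
      \<le> (a + b + 1) / a * (a * K + (b + 1) * K)"
    by (rule mult_left_mono) (use a b in simp)
  also have "(a + b + 1) / a * (a * (v s t * (s powr (a + b + 1) / (a + b + 1))))
      = v s t * s powr (a + b + 1)"
    using a b by simp
  also have "(a + b + 1) / a * (a * K + (b + 1) * K) = (a + b + 1) * ((a * K + (b + 1) * K) / a)"
    by simp
  also have "(a * K + (b + 1) * K) / a = (1 + (b + 1) / a) * K"
    using a by (simp add: add_divide_distrib distrib_right)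
  also have "(a + b + 1) * ((1 + (b + 1) / a) * K) = (a + b + 1) * (1 + (b + 1) / a) * K"
    by (rule mult.assoc[symmetric])
  finally show ?thesis .
qed

section \<open>The inequality with exponent one\<close>

text \<open>A pointwise bound \<open>v \<le> L r\<^bsup>-p\<^esup>\<close> trades the excess power \<open>v\<^bsup>1/p\<^esup>\<close> for a factor \<open>1 / r\<close>.\<close>

lemma powr_interpolate:
  fixes v r p L :: real
  assumes "0 \<le> v" "0 < r" "0 < p" "v * r powr p \<le> L"
  shows "v powr ((p + 1) / p) \<le> L powr (1 / p) * (v / r)"
proof -
  have "v powr (1 / p) * r = (v * r powr p) powr (1 / p)"
    using assms by (simp add: powr_mult powr_powr)
  also have "\<dots> \<le> L powr (1 / p)"
    using assms by (intro powr_mono2) auto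
  finally have "v powr (1 / p) \<le> L powr (1 / p) / r"
    using assms by (simp add: field_simps)
  moreover have "v powr ((p + 1) / p) = v * v powr (1 / p)"
    using assms by (cases "v = 0") (auto simp: add_divide_distrib powr_add)
  ultimately show ?thesis
    using assms mult_left_mono[of "v powr (1 / p)" "L powr (1 / p) / r" v] by (simp add: mult_ac)
qed

text \<open>Here \<open>g\<close> and \<open>h\<close> stand for \<open>-v\<^sub>s\<close> and \<open>-v\<^sub>t\<close>, and \<open>(p + 1) / p\<close> is the Sobolev exponent
  \<open>D / (D - 1)\<close>.\<close>

lemma sobolev_exponent_one_fst_pos:
  assumes a: "0 < a" and b: "-1 < b" and p: "p = 1 + a + b"
  shows "\<exists>M>0. \<forall>v g h K. tail_density v g \<longrightarrow> tail_density (\<lambda>t s. v s t) (\<lambda>t s. h s t) \<longrightarrow>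
    0 \<le> K \<longrightarrow> quad_int a b g \<le> ennreal K \<longrightarrow> quad_int a b h \<le> ennreal K \<longrightarrow>
    quad_int a b (\<lambda>s t. v s t powr ((p + 1) / p)) \<le> ennreal (M * K powr ((p + 1) / p))"
proof (cases "b \<le> 0")
  case True
  define N where "N = p * (1 + (b + 1) / a)"
  have p0: "0 < p" and N: "0 < N"
    using a b by (auto simp: N_def p add_pos_pos)
  show ?thesis
  proof (intro exI[of _ "N powr (1 / p) / a"] conjI allI impI)
    show "0 < N powr (1 / p) / a" using N a by simp
    fix v g h K
    assume v: "tail_density v g" and w: "tail_density (\<lambda>t s. v s t) (\<lambda>t s. h s t)" and K: "0 \<le> K"
      and A: "quad_int a b g \<le> ennreal K" and B: "quad_int a b h \<le> ennreal K"
    have m: "(\<lambda>(s, t). v s t) \<in> borel_measurable (lborel \<Otimes>\<^sub>M lborel)" and nn: "\<And>s t. 0 \<le> v s t"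
      using v by (auto simp: tail_density_def)
    note [measurable] = m
    have H: "ennreal a * quad_int (a - 1) b v \<le> ennreal K"
      using A tail_density_hardy[OF v a] by simp
    define c where "c = (N * K) powr (1 / p)"
    have "v s t powr ((p + 1) / p) \<le> c * (v s t / s)" if "0 < s" "0 < t" for s t
      unfolding c_def
    proof (rule powr_interpolate)
      show "v s t * s powr p \<le> N * K"
        using decreasing_bound_by_edge[OF tail_density_decreasing[OF v] w a b True K H B that]
        by (simp add: p N_def add_ac)
    qed (use nn that p0 in auto)
    then have "quad_int a b (\<lambda>s t. v s t powr ((p + 1) / p)) \<le> quad_int a b (\<lambda>s t. c * (v s t / s))"
      by (intro quad_int_mono mult_left_mono) auto
    also have "\<dots> = ennreal c * quad_int (a - 1) b v"
      by (subst quad_int_cmult) (auto simp: quad_int_divide_fst c_def)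
    also have "\<dots> = ennreal (c / a) * (ennreal a * quad_int (a - 1) b v)"
      using a by (simp add: c_def mult.assoc[symmetric] flip: ennreal_mult)
    also have "\<dots> \<le> ennreal (c / a) * ennreal K"
      by (rule mult_left_mono[OF H]) simp
    also have "\<dots> = ennreal (N powr (1 / p) / a * K powr ((p + 1) / p))"
      using a K N p0 by (cases "K = 0") (auto simp: c_def powr_mult add_divide_distrib powr_add mult_ac simp flip: ennreal_mult)
    finally show "quad_int a b (\<lambda>s t. v s t powr ((p + 1) / p)) \<le> ennreal (N powr (1 / p) / a * K powr ((p + 1) / p))" .
  qed
next
  case False
  then have b0: "0 < b" by simp
  define N where "N = a + b + 2"
  have p0: "0 < p" and N: "0 < N"
    using a b0 by (auto simp: N_def p)
  show ?thesis
  proof (intro exI[of _ "N powr (1 / p) * (1 / a + 1 / b)"] conjI allI impI)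
    show "0 < N powr (1 / p) * (1 / a + 1 / b)" using N a b0 by (simp add: add_pos_pos)
    fix v g h K
    assume v: "tail_density v g" and w: "tail_density (\<lambda>t s. v s t) (\<lambda>t s. h s t)" and K: "0 \<le> K"
      and A: "quad_int a b g \<le> ennreal K" and B: "quad_int a b h \<le> ennreal K"
    have m: "(\<lambda>(s, t). v s t) \<in> borel_measurable (lborel \<Otimes>\<^sub>M lborel)" and nn: "\<And>s t. 0 \<le> v s t"
      using v by (auto simp: tail_density_def)
    have m': "(\<lambda>(s, t). v t s) \<in> borel_measurable (lborel \<Otimes>\<^sub>M lborel)"
      "(\<lambda>(s, t). h t s) \<in> borel_measurable (lborel \<Otimes>\<^sub>M lborel)"
      using w by (auto simp: tail_density_def)
    note [measurable] = m m'
    have H: "ennreal a * quad_int (a - 1) b v \<le> ennreal K"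
      using A tail_density_hardy[OF v a] by simp
    have "ennreal b * quad_int (b - 1) a (\<lambda>t s. v s t) = quad_int a b h"
      using tail_density_hardy[OF w b0, of a] quad_int_commute[OF m'(2), of b a] by simp
    then have H': "ennreal b * quad_int (b - 1) a (\<lambda>t s. v s t) \<le> ennreal K"
      using B by simp
    define c where "c = (N * K) powr (1 / p)"
    have c0: "0 \<le> c" by (simp add: c_def)
    have *: "v s t powr ((p + 1) / p) \<le> c * (v s t / s + v s t / t)" if st: "0 < s" "0 < t" for s t
    proof (cases "s \<le> t")
      case True
      have "v s t * s powr p = v s t * s powr a * s powr (b + 1)"
        using st by (simp add: p add_ac mult.assoc flip: powr_add)
      also have "\<dots> \<le> v s t * s powr a * t powr (b + 1)"
        using True st nn b0 by (intro mult_left_mono powr_mono2) auto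
      also have "\<dots> \<le> (b + 1) * K"
        using b by (intro decreasing_pointwise_bound[OF tail_density_decreasing[OF v] tail_density_decreasing[OF w] nn a b H K st])
      also have "\<dots> \<le> N * K"
        using a K by (intro mult_right_mono) (auto simp: N_def)
      finally have "v s t powr ((p + 1) / p) \<le> c * (v s t / s)"
        unfolding c_def using nn st p0 by (intro powr_interpolate) auto
      also have "\<dots> \<le> c * (v s t / s + v s t / t)"
        using nn st c0 by (intro mult_left_mono) auto
      finally show ?thesis .
    next
      case False
      have "v s t * t powr p = v s t * t powr b * t powr (a + 1)"
        using st by (simp add: p add_ac mult.assoc flip: powr_add)
      also have "\<dots> \<le> v s t * t powr b * s powr (a + 1)"
        using False st nn a by (intro mult_left_mono powr_mono2) auto
      also have "\<dots> \<le> (a + 1) * K"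
        using a decreasing_pointwise_bound[OF tail_density_decreasing[OF w] tail_density_decreasing[OF v] nn b0 _ H' K st(2,1)]
        by simp
      also have "\<dots> \<le> N * K"
        using b0 K by (intro mult_right_mono) (auto simp: N_def)
      finally have "v s t powr ((p + 1) / p) \<le> c * (v s t / t)"
        unfolding c_def using nn st p0 by (intro powr_interpolate) auto
      also have "\<dots> \<le> c * (v s t / s + v s t / t)"
        using nn st c0 by (intro mult_left_mono) auto
      finally show ?thesis .
    qed
    have "quad_int a b (\<lambda>s t. v s t powr ((p + 1) / p)) \<le> quad_int a b (\<lambda>s t. c * (v s t / s + v s t / t))"
      using * by (intro quad_int_mono mult_left_mono) auto
    also have "\<dots> = ennreal c * (quad_int (a - 1) b v + quad_int a (b - 1) v)"
      using nn by (simp add: quad_int_cmult quad_int_add quad_int_divide_fst quad_int_divide_snd c0)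
    also have "quad_int a (b - 1) v = quad_int (b - 1) a (\<lambda>t s. v s t)"
      by (rule quad_int_commute[OF m])
    also have "ennreal c * (quad_int (a - 1) b v + quad_int (b - 1) a (\<lambda>t s. v s t))
       = ennreal (c / a) * (ennreal a * quad_int (a - 1) b v)
       + ennreal (c / b) * (ennreal b * quad_int (b - 1) a (\<lambda>t s. v s t))"
      using a b0 c0 by (simp add: mult.assoc[symmetric] distrib_left flip: ennreal_mult)
    also have "\<dots> \<le> ennreal (c / a) * ennreal K + ennreal (c / b) * ennreal K"
      by (intro add_mono mult_left_mono H H') auto
    also have "\<dots> = ennreal (c * K * (1 / a + 1 / b))"
      using a b0 c0 K by (simp add: algebra_simps flip: ennreal_mult ennreal_plus)
    also have "c * K = N powr (1 / p) * K powr ((p + 1) / p)"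
      using K N p0 by (cases "K = 0") (auto simp: c_def powr_mult add_divide_distrib powr_add mult_ac)
    finally show "quad_int a b (\<lambda>s t. v s t powr ((p + 1) / p))
        \<le> ennreal (N powr (1 / p) * (1 / a + 1 / b) * K powr ((p + 1) / p))"
      by (simp add: mult_ac)
  qed
qed

lemma sobolev_exponent_one:
  assumes a: "-1 < a" and b: "-1 < b" and ab: "0 < a \<or> 0 < b" and p: "p = 1 + a + b"
  shows "\<exists>M>0. \<forall>v g h K. tail_density v g \<longrightarrow> tail_density (\<lambda>t s. v s t) (\<lambda>t s. h s t) \<longrightarrow>
    0 \<le> K \<longrightarrow> quad_int a b g \<le> ennreal K \<longrightarrow> quad_int a b h \<le> ennreal K \<longrightarrow>
    quad_int a b (\<lambda>s t. v s t powr ((p + 1) / p)) \<le> ennreal (M * K powr ((p + 1) / p))"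
proof (cases "0 < a")
  case True
  then show ?thesis
    using sobolev_exponent_one_fst_pos[OF True b p] by blast
next
  case False
  then have b0: "0 < b" and p': "p = 1 + b + a" using ab p by auto
  obtain M where M: "M > 0" and *: "\<And>v g h K. tail_density v g \<Longrightarrow> tail_density (\<lambda>t s. v s t) (\<lambda>t s. h s t) \<Longrightarrow>
    0 \<le> K \<Longrightarrow> quad_int b a g \<le> ennreal K \<Longrightarrow> quad_int b a h \<le> ennreal K \<Longrightarrow>
    quad_int b a (\<lambda>s t. v s t powr ((p + 1) / p)) \<le> ennreal (M * K powr ((p + 1) / p))"
    using sobolev_exponent_one_fst_pos[OF b0 a p'] by blast
  show ?thesis
  proof (intro exI[of _ M] conjI M allI impI)
    fix v g h K
    assume v: "tail_density v g" and w: "tail_density (\<lambda>t s. v s t) (\<lambda>t s. h s t)" and K: "0 \<le> K"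
      and A: "quad_int a b g \<le> ennreal K" and B: "quad_int a b h \<le> ennreal K"
    have [measurable]: "case_prod v \<in> borel_measurable (lborel \<Otimes>\<^sub>M lborel)"
      "case_prod g \<in> borel_measurable (lborel \<Otimes>\<^sub>M lborel)"
      using v by (auto simp: tail_density_def)
    have [measurable]: "(\<lambda>(s, t). h t s) \<in> borel_measurable (lborel \<Otimes>\<^sub>M lborel)"
      using w by (auto simp: tail_density_def)
    have "quad_int a b (\<lambda>s t. v s t powr ((p + 1) / p)) = quad_int b a (\<lambda>t s. v s t powr ((p + 1) / p))"
      by (rule quad_int_commute) measurable
    also have "\<dots> \<le> ennreal (M * K powr ((p + 1) / p))"
    proof (rule *)
      show "quad_int b a (\<lambda>t s. h s t) \<le> ennreal K"
        using B by (subst quad_int_commute) auto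
      show "quad_int b a (\<lambda>t s. g s t) \<le> ennreal K"
        using A by (subst quad_int_commute) measurable
    qed (use v w K in auto)
    finally show "quad_int a b (\<lambda>s t. v s t powr ((p + 1) / p)) \<le> ennreal (M * K powr ((p + 1) / p))" .
  qed
qed

section \<open>Functions of one variable with negative derivative where positive\<close>

text \<open>The derivative is controlled only where \<open>f\<close> is positive, but \<open>f\<close> cannot become positive again
  after a zero: it would have to increase just after the last zero.\<close>

lemma decreasing_if_neg_deriv_where_pos:
  fixes f f' :: "real \<Rightarrow> real"
  assumes cont: "continuous_on UNIV f" and nn: "\<And>x. 0 \<le> f x"
    and der: "\<And>x. 0 < x \<Longrightarrow> 0 < f x \<Longrightarrow> (f has_real_derivative f' x) (at x) \<and> f' x < 0"
    and y: "0 < y" "y \<le> x"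
  shows "f x \<le> f y"
proof (cases "f x = 0 \<or> x = y")
  case True
  then show ?thesis using nn by auto
next
  case False
  then have fx: "0 < f x" and yx: "y < x" using nn[of x] y by auto
  define Z where "Z = {y..x} \<inter> f -` {0}"
  have dec: "f x < f z" if "y \<le> z" "z < x" "\<And>w. z < w \<Longrightarrow> w < x \<Longrightarrow> 0 < f w" for z
  proof (rule DERIV_neg_imp_decreasing_open[OF that(2)])
    show "\<exists>d. (f has_real_derivative d) (at w) \<and> d < 0" if "z < w" "w < x" for w
      using der[of w] \<open>\<And>w. z < w \<Longrightarrow> w < x \<Longrightarrow> 0 < f w\<close>[OF that] that \<open>y \<le> z\<close> y by auto
    show "continuous_on {z..x} f"
      using cont continuous_on_subset by blast
  qed
  \<comment> \<open>otherwise \<open>f\<close> would decrease from its last zero before \<open>x\<close> to the positive value \<open>f x\<close>\<close>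
  have "Z = {}"
  proof (rule ccontr)
    assume ne: "Z \<noteq> {}"
    have "compact Z"
      unfolding Z_def by (intro compact_Int_closed compact_Icc continuous_closed_vimage)
        (use cont in \<open>auto simp: continuous_on_eq_continuous_at\<close>)
    then obtain z where z: "z \<in> Z" "\<And>w. w \<in> Z \<Longrightarrow> w \<le> z"
      using ne compact_attains_sup by metis
    have "z \<noteq> x" using z(1) fx by (auto simp: Z_def)
    then have "f x < f z"
    proof (intro dec)
      show "0 < f w" if "z < w" "w < x" for w
      proof -
        have "w \<notin> Z" using z(2)[of w] that by auto
        then have "f w \<noteq> 0" using z(1) that by (auto simp: Z_def)
        then show ?thesis using nn[of w] by simp
      qed
    qed (use z in \<open>auto simp: Z_def\<close>)
    then show False using z nn[of x] by (auto simp: Z_def)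
  qed
  then have "f x < f y"
    using nn yx by (intro dec) (force simp: Z_def less_le)+
  then show ?thesis by simp
qed

text \<open>The fundamental theorem of calculus on the open interval from \<open>s\<close> to the first zero \<open>c\<close> beyond
  \<open>s\<close>; differentiability at \<open>c\<close> is not needed.\<close>

lemma nn_integral_neg_deriv_powr:
  fixes f f' :: "real \<Rightarrow> real"
  assumes cont: "continuous_on UNIV f" and nn: "\<And>x. 0 \<le> f x"
    and der: "\<And>x. 0 < x \<Longrightarrow> 0 < f x \<Longrightarrow> (f has_real_derivative f' x) (at x) \<and> f' x < 0"
    and cont': "\<And>x. 0 < x \<Longrightarrow> 0 < f x \<Longrightarrow> isCont f' x"
    and zero: "\<And>x. R \<le> x \<Longrightarrow> f x = 0"
    and k: "0 < k" and s: "0 < s"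
  shows "ennreal (f s powr k) =
    (\<integral>\<^sup>+x. ennreal (if 0 < x \<and> 0 < f x then k * f x powr (k - 1) * - f' x else 0) * indicator {s<..} x \<partial>lborel)"
proof (cases "f s = 0")
  case True
  have "f x = 0" if "s < x" for x
    using decreasing_if_neg_deriv_where_pos[OF cont nn der s, of x] that True nn[of x] by auto
  then have "ennreal (if 0 < x \<and> 0 < f x then k * f x powr (k - 1) * - f' x else 0) * indicator {s<..} x = 0" for x
    by (cases "s < x") auto
  then show ?thesis using True by (simp only: nn_integral_const) simp
next
  case False
  define Z where "Z = {s..R} \<inter> f -` {0}"
  have "s < R" using zero[of s] False by force
  then have ne: "R \<in> Z" using zero by (auto simp: Z_def)
  have "compact Z"
    unfolding Z_def by (intro compact_Int_closed compact_Icc continuous_closed_vimage)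
      (use cont in \<open>auto simp: continuous_on_eq_continuous_at\<close>)
  then obtain c where c: "c \<in> Z" "\<And>w. w \<in> Z \<Longrightarrow> c \<le> w"
    using ne compact_attains_inf by (metis empty_iff)
  have fc: "f c = 0" and sc: "s < c" using c False by (auto simp: Z_def less_le)
  have pos: "0 < f x" if "s \<le> x" "x < c" for x
    using c that nn[of x] by (force simp: Z_def less_le)
  have after: "f x = 0" if "c \<le> x" for x
    using decreasing_if_neg_deriv_where_pos[OF cont nn der _ that] s sc fc nn[of x] by auto
  let ?g = "\<lambda>x. k * f x powr (k - 1) * - f' x"
  let ?F = "\<lambda>x. - (f x powr k)"
  have fcont: "isCont f x" for x
    using cont by (simp add: continuous_on_eq_continuous_at)
  have Fcont: "isCont ?F x" for x
    unfolding isCont_def using k nn fcont[of x]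
    by (intro tendsto_minus tendsto_powr') (auto simp: isCont_def)
  have lim: "(?F \<longlongrightarrow> ?F x) (at x within S)" for x S
    using Fcont[of x] tendsto_within_subset[OF Fcont[of x, unfolded isCont_def]] by simp
  have ge0: "0 \<le> ?g x" if "s < x" "x < c" for x
    using der[of x] pos[of x] that s k by (auto simp: mult_nonneg_nonpos)
  note FTC = interval_integral_FTC_nonneg[of "ereal s" "ereal c" ?F ?g "?F s" "?F c"]
  have prem: "DERIV ?F x :> ?g x" "isCont ?g x" if "s < x" "x < c" for x
  proof -
    have x: "0 < x" "0 < f x" using that pos[of x] s by auto
    note [derivative_intros] = der[OF x, THEN conjunct1]
    show "DERIV ?F x :> ?g x"
      using x by (auto intro!: derivative_eq_intros simp: field_simps)
    show "isCont ?g x"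
      using x by (intro continuous_intros cont' fcont) auto
  qed
  have "set_integrable lborel {s<..<c} ?g" and "(LBINT x=s..c. ?g x) = ?F c - ?F s"
    using FTC sc prem ge0 lim by (auto simp: ereal_tendsto_simps1)
  then have I: "integrable lborel (\<lambda>x. indicator {s<..<c} x * ?g x)"
      "(\<integral>x. indicator {s<..<c} x * ?g x \<partial>lborel) = f s powr k"
    using sc fc k by (auto simp: set_integrable_def interval_lebesgue_integral_def set_lebesgue_integral_def)
  have "(\<integral>\<^sup>+x. ennreal (indicator {s<..<c} x * ?g x) \<partial>lborel) = ennreal (f s powr k)"
    using I ge0 by (subst nn_integral_eq_integral) (auto simp: indicator_def)
  moreover have "ennreal (if 0 < x \<and> 0 < f x then ?g x else 0) * indicator {s<..} x
      = ennreal (indicator {s<..<c} x * ?g x)" for x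
    using pos[of x] after[of x] s by (auto simp: indicator_def)
  ultimately show ?thesis by simp
qed

text \<open>For nonnegative decreasing \<open>f\<close>: \<open>f\<close> vanishes at the positive point \<open>x\<close>, but nowhere between
  \<open>0\<close> and \<open>x\<close>. Quantifying over the points \<open>x - 1 / (n + 1)\<close> only, instead of all points to the left of
  \<open>x\<close>, makes the condition visibly measurable in parameters.\<close>

definition first_zero :: "(real \<Rightarrow> real) \<Rightarrow> real \<Rightarrow> bool"
  where "first_zero f x \<longleftrightarrow> 0 < x \<and> f x = 0 \<and> (\<forall>n::nat. x \<le> 1 / (n + 1) \<or> f (x - 1 / (n + 1)) \<noteq> 0)"

lemma first_zero_unique:
  assumes dec: "\<And>x y. 0 < y \<Longrightarrow> y \<le> x \<Longrightarrow> f x \<le> f y" and nn: "\<And>x. 0 \<le> f x"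
    and "first_zero f x" "first_zero f y"
  shows "x = (y::real)"
proof -
  have "\<not> x < y" if "first_zero f x" "first_zero f y" for x y
  proof
    assume "x < y"
    then obtain n where n: "inverse (real (Suc n)) < y - x"
      using reals_Archimedean[of "y - x"] by auto
    have "0 < x" "f x = 0" using that(1) by (auto simp: first_zero_def)
    then have "f (y - 1 / (real n + 1)) \<le> 0"
      using dec[of x "y - 1 / (real n + 1)"] n by (auto simp: inverse_eq_divide add.commute)
    then have "f (y - 1 / (real n + 1)) = 0" using nn by (simp add: order_antisym)
    moreover have "1 / (real n + 1) < y" using n \<open>0 < x\<close> by (auto simp: inverse_eq_divide add.commute)
    moreover have "y \<le> 1 / (real n + 1) \<or> f (y - 1 / (real n + 1)) \<noteq> 0"
      using that(2) unfolding first_zero_def by blast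
    ultimately show False by simp
  qed
  then show ?thesis using assms(3,4) by (meson linorder_neqE_linordered_idom)
qed

lemma deriv_zero_after_first_zero:
  assumes dec: "\<And>x y. 0 < y \<Longrightarrow> y \<le> x \<Longrightarrow> f x \<le> f y" and nn: "\<And>x. 0 \<le> f x"
    and x: "0 < x" "f x = 0" "\<not> first_zero f x"
  shows "deriv f (x::real) = (0::real)"
proof -
  obtain n :: nat where n: "1 / (real n + 1) < x" "f (x - 1 / (real n + 1)) = 0"
    using x by (auto simp: first_zero_def not_le)
  define y where "y = x - 1 / (real n + 1)"
  have y: "0 < y" "y < x" "f y = 0" using n by (auto simp: y_def)
  have "f z = 0" if "z \<in> {y<..}" for z
    using dec[of y z] nn[of z] y that by auto
  moreover have "((\<lambda>_. 0) has_real_derivative 0) (at x)" by simp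
  ultimately have "(f has_real_derivative 0) (at x)"
    using y by (subst has_field_derivative_cong_ev[where g="\<lambda>_. 0" and y = x])
      (auto intro!: eventually_nhds_in_open[THEN eventually_mono, of "{y<..}"])
  then show ?thesis by (rule DERIV_imp_deriv)
qed

section \<open>Admissible functions\<close>

text \<open>The gradient on the part of the quadrant where \<open>u\<close> is positive, extended by zero. For
  admissible \<open>u\<close> it is Borel measurable, whatever the unspecified values of \<^const>\<open>grad\<close>.\<close>

definition pos_grad :: "(real \<times> real \<Rightarrow> real) \<Rightarrow> real \<times> real \<Rightarrow> real \<times> real"
  where "pos_grad u x = (if x \<in> pos_quadrant \<and> 0 < u x then grad u x else 0)"

lemma admissible_nonneg: "admissible u \<Longrightarrow> 0 \<le> u x"
  unfolding admissible_def by blast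

lemma admissible_continuous: "admissible u \<Longrightarrow> continuous_on UNIV u"
  using lipschitz_on_continuous_on by (auto simp: admissible_def)

lemma admissible_open_pos: "admissible u \<Longrightarrow> open {x. 0 < u x}"
  by (intro open_Collect_less continuous_on_const admissible_continuous)

lemma open_pos_quadrant: "open pos_quadrant"
  by (simp add: pos_quadrant_def open_Times)

lemma admissible_isCont_grad:
  assumes "admissible u" "0 < u x"
  shows "isCont (grad u) x"
proof -
  have "continuous_on {x. 0 < u x} (grad u)"
    using assms(1) unfolding admissible_def C1_on_def by blast
  then show ?thesis
    using continuous_on_eq_continuous_at[OF admissible_open_pos[OF assms(1)]] assms(2) by blast
qed

lemma admissible_deriv_fst:
  assumes u: "admissible u" and "0 < s" "0 < t" "0 < u (s, t)"
  shows "((\<lambda>s. u (s, t)) has_real_derivative d_sigma u (s, t)) (at s) \<and> d_sigma u (s, t) < 0"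
proof -
  have "(\<lambda>s. u (s, t)) field_differentiable at s" and "d_sigma u (s, t) < 0"
    using assms by (force simp: admissible_def C1_on_def pos_quadrant_def)+
  then show ?thesis
    by (simp add: d_sigma_def DERIV_deriv_iff_field_differentiable)
qed

lemma admissible_deriv_snd:
  assumes u: "admissible u" and "0 < s" "0 < t" "0 < u (s, t)"
  shows "((\<lambda>t. u (s, t)) has_real_derivative d_tau u (s, t)) (at t) \<and> d_tau u (s, t) < 0"
proof -
  have "(\<lambda>t. u (s, t)) field_differentiable at t" and "d_tau u (s, t) < 0"
    using assms by (force simp: admissible_def C1_on_def pos_quadrant_def)+
  then show ?thesis
    by (simp add: d_tau_def DERIV_deriv_iff_field_differentiable)
qed

lemma admissible_isCont_d_sigma:
  assumes "admissible u" "0 < u (s, t)"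
  shows "isCont (\<lambda>s. d_sigma u (s, t)) s"
proof -
  have "isCont (\<lambda>s. (s, t)) s"
    by (intro continuous_intros)
  then have "isCont (\<lambda>s. grad u (s, t)) s"
    by (rule isCont_o2) (rule admissible_isCont_grad[OF assms])
  then have "isCont (\<lambda>s. fst (grad u (s, t))) s"
    by (rule continuous_fst)
  then show ?thesis by (simp add: grad_def)
qed

lemma admissible_isCont_d_tau:
  assumes "admissible u" "0 < u (s, t)"
  shows "isCont (\<lambda>t. d_tau u (s, t)) t"
proof -
  have "isCont (\<lambda>t. (s, t)) t"
    by (intro continuous_intros)
  then have "isCont (\<lambda>t. grad u (s, t)) t"
    by (rule isCont_o2) (rule admissible_isCont_grad[OF assms])
  then have "isCont (\<lambda>t. snd (grad u (s, t))) t"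
    by (rule continuous_snd)
  then show ?thesis by (simp add: grad_def)
qed

lemma admissible_continuous_sections:
  assumes "admissible u"
  shows "continuous_on UNIV (\<lambda>s. u (s, t))" "continuous_on UNIV (\<lambda>t. u (s, t))"
  by (rule continuous_on_compose2[OF admissible_continuous[OF assms]]; auto intro!: continuous_intros)+

lemma admissible_support:
  assumes "admissible u"
  obtains R where "0 < R" "\<And>s t. R \<le> s \<or> R \<le> t \<Longrightarrow> u (s, t) = 0"
proof -
  have "bounded (closure {x. u x \<noteq> 0})"
    using assms by (auto simp: admissible_def compactly_supported_def compact_imp_bounded)
  then obtain B where B: "0 < B" "\<And>x. x \<in> closure {x. u x \<noteq> 0} \<Longrightarrow> norm x \<le> B"
    by (auto simp: bounded_pos)
  have small: "s \<le> B \<and> t \<le> B" if "u (s, t) \<noteq> 0" for s t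
  proof -
    have "(s, t) \<in> closure {x. u x \<noteq> 0}"
      by (rule subsetD[OF closure_subset]) (use that in simp)
    then have "norm (s, t) \<le> B" by (rule B(2))
    then show ?thesis
      using norm_fst_le[of s t] norm_snd_le[of t s] by auto
  qed
  show ?thesis
  proof (rule that[of "B + 1"])
    show "u (s, t) = 0" if "B + 1 \<le> s \<or> B + 1 \<le> t" for s t
      using small[of s t] that by force
  qed (use B in simp)
qed

lemma admissible_bounded:
  assumes "admissible u"
  obtains B where "\<And>x. u x \<le> B"
proof -
  define S where "S = closure {x. u x \<noteq> 0}"
  have "compact (u ` S)"
    using assms continuous_on_subset[OF admissible_continuous[OF assms]]
    by (intro compact_continuous_image) (auto simp: S_def admissible_def compactly_supported_def)
  then obtain B where B: "0 < B" "\<And>x. x \<in> S \<Longrightarrow> norm (u x) \<le> B"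
    by (auto dest!: compact_imp_bounded simp: bounded_pos)
  have "u x \<le> B" for x
  proof (cases "u x = 0")
    case False
    then have "x \<in> S" unfolding S_def by (intro subsetD[OF closure_subset]) simp
    then show ?thesis using B(2) by fastforce
  qed (use B in simp)
  then show ?thesis by (rule that)
qed

lemma measurable_lborel_pair: "f \<in> borel_measurable (borel :: (real \<times> real) measure)
    \<Longrightarrow> f \<in> borel_measurable (lborel \<Otimes>\<^sub>M lborel)"
  by (simp add: lborel_prod)

lemma admissible_measurable:
  assumes "admissible u"
  shows "u \<in> borel_measurable (lborel \<Otimes>\<^sub>M lborel)"
  by (intro measurable_lborel_pair borel_measurable_continuous_onI admissible_continuous assms)

lemma pos_grad_measurable:
  assumes "admissible u"
  shows "pos_grad u \<in> borel_measurable (lborel \<Otimes>\<^sub>M lborel)"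
proof (rule measurable_lborel_pair)
  let ?S = "pos_quadrant \<inter> {x. 0 < u x}"
  have "(\<lambda>x. if x \<in> ?S then grad u x else 0) \<in> borel_measurable borel"
  proof (rule borel_measurable_continuous_on_if)
    show "?S \<in> sets borel"
      using open_pos_quadrant admissible_open_pos[OF assms] by (intro borel_open open_Int)
    show "continuous_on ?S (grad u)"
      using admissible_isCont_grad[OF assms] by (intro continuous_at_imp_continuous_on) auto
  qed simp
  then show "pos_grad u \<in> borel_measurable borel"
    by (simp add: pos_grad_def[abs_def])
qed

lemma pos_grad_components_measurable:
  assumes "admissible u"
  shows "(\<lambda>(s, t). fst (pos_grad u (s, t))) \<in> borel_measurable (lborel \<Otimes>\<^sub>M lborel)"
    "(\<lambda>(s, t). snd (pos_grad u (s, t))) \<in> borel_measurable (lborel \<Otimes>\<^sub>M lborel)"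
    "(\<lambda>(s, t). norm (pos_grad u (s, t))) \<in> borel_measurable (lborel \<Otimes>\<^sub>M lborel)"
  by (auto simp: case_prod_unfold intro!: measurable_compose[OF pos_grad_measurable[OF assms]]
      borel_measurable_continuous_onI continuous_intros)

lemma pos_grad_nonpos:
  assumes "admissible u"
  shows "fst (pos_grad u x) \<le> 0" "snd (pos_grad u x) \<le> 0"
  using admissible_deriv_fst[OF assms, of "fst x" "snd x"] admissible_deriv_snd[OF assms, of "fst x" "snd x"]
  by (auto simp: pos_grad_def grad_def pos_quadrant_def mem_Times_iff)

lemma tail_density_admissible_fst:
  assumes u: "admissible u" and k: "0 < k"
  shows "tail_density (\<lambda>s t. u (s, t) powr k)
    (\<lambda>s t. k * u (s, t) powr (k - 1) * - fst (pos_grad u (s, t)))"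
proof -
  note [measurable] = admissible_measurable[OF u] pos_grad_components_measurable[OF u]
  obtain R where R: "\<And>s t. R \<le> s \<or> R \<le> t \<Longrightarrow> u (s, t) = 0"
    using admissible_support[OF u] by metis
  have "ennreal (u (s, t) powr k) = (\<integral>\<^sup>+x. ennreal (k * u (x, t) powr (k - 1) * - fst (pos_grad u (x, t)))
      * indicator {s<..} x \<partial>lborel)" if "0 < s" "0 < t" for s t
  proof -
    have "ennreal (u (s, t) powr k) = (\<integral>\<^sup>+x. ennreal (if 0 < x \<and> 0 < u (x, t)
        then k * u (x, t) powr (k - 1) * - d_sigma u (x, t) else 0) * indicator {s<..} x \<partial>lborel)"
      using R that k by (intro nn_integral_neg_deriv_powr[where R = R] admissible_continuous_sections
        admissible_deriv_fst admissible_isCont_d_sigma admissible_nonneg u) auto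
    also have "\<dots> = (\<integral>\<^sup>+x. ennreal (k * u (x, t) powr (k - 1) * - fst (pos_grad u (x, t)))
      * indicator {s<..} x \<partial>lborel)"
      using that by (intro nn_integral_cong) (auto simp: pos_grad_def pos_quadrant_def grad_def)
    finally show ?thesis .
  qed
  moreover have "0 \<le> k * u (s, t) powr (k - 1) * - fst (pos_grad u (s, t))" for s t
    using k pos_grad_nonpos[OF u] by (intro mult_nonneg_nonneg) auto
  moreover have "(\<lambda>(s, t). u (s, t) powr k) \<in> borel_measurable (lborel \<Otimes>\<^sub>M lborel)"
    "(\<lambda>(s, t). k * u (s, t) powr (k - 1) * - fst (pos_grad u (s, t))) \<in> borel_measurable (lborel \<Otimes>\<^sub>M lborel)"
    by measurable
  ultimately show ?thesis
    unfolding tail_density_def by (intro conjI allI impI powr_ge_zero)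
qed

lemma tail_density_admissible_snd:
  assumes u: "admissible u" and k: "0 < k"
  shows "tail_density (\<lambda>t s. u (s, t) powr k)
    (\<lambda>t s. k * u (s, t) powr (k - 1) * - snd (pos_grad u (s, t)))"
proof -
  note [measurable] = admissible_measurable[OF u] pos_grad_components_measurable[OF u]
  obtain R where R: "\<And>s t. R \<le> s \<or> R \<le> t \<Longrightarrow> u (s, t) = 0"
    using admissible_support[OF u] by metis
  have "ennreal (u (s, t) powr k) = (\<integral>\<^sup>+y. ennreal (k * u (s, y) powr (k - 1) * - snd (pos_grad u (s, y)))
      * indicator {t<..} y \<partial>lborel)" if "0 < s" "0 < t" for s t
  proof -
    have "ennreal (u (s, t) powr k) = (\<integral>\<^sup>+y. ennreal (if 0 < y \<and> 0 < u (s, y)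
        then k * u (s, y) powr (k - 1) * - d_tau u (s, y) else 0) * indicator {t<..} y \<partial>lborel)"
      using R that k by (intro nn_integral_neg_deriv_powr[where R = R] admissible_continuous_sections
        admissible_deriv_snd admissible_isCont_d_tau admissible_nonneg u) auto
    also have "\<dots> = (\<integral>\<^sup>+y. ennreal (k * u (s, y) powr (k - 1) * - snd (pos_grad u (s, y)))
      * indicator {t<..} y \<partial>lborel)"
      using that by (intro nn_integral_cong) (auto simp: pos_grad_def pos_quadrant_def grad_def)
    finally show ?thesis .
  qed
  moreover have "0 \<le> k * u (s, t) powr (k - 1) * - snd (pos_grad u (s, t))" for s t
    using k pos_grad_nonpos[OF u] by (intro mult_nonneg_nonneg) auto
  moreover have "(\<lambda>(t, s). u (s, t) powr k) \<in> borel_measurable (lborel \<Otimes>\<^sub>M lborel)"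
    "(\<lambda>(t, s). k * u (s, t) powr (k - 1) * - snd (pos_grad u (s, t))) \<in> borel_measurable (lborel \<Otimes>\<^sub>M lborel)"
    by measurable
  ultimately show ?thesis
    unfolding tail_density_def by (intro conjI allI impI powr_ge_zero)
qed

lemma admissible_decreasing:
  assumes u: "admissible u"
  shows "0 < s \<Longrightarrow> s \<le> s' \<Longrightarrow> 0 < t \<Longrightarrow> u (s', t) \<le> u (s, t)"
    and "0 < s \<Longrightarrow> 0 < t \<Longrightarrow> t \<le> t' \<Longrightarrow> u (s, t') \<le> u (s, t)"
proof -
  show "u (s', t) \<le> u (s, t)" if "0 < s" "s \<le> s'" "0 < t"
    using that
    by (intro decreasing_if_neg_deriv_where_pos[where f = "\<lambda>s. u (s, t)" and f' = "\<lambda>s. d_sigma u (s, t)"]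
        admissible_continuous_sections admissible_deriv_fst admissible_nonneg u) auto
  show "u (s, t') \<le> u (s, t)" if "0 < s" "0 < t" "t \<le> t'"
    using that
    by (intro decreasing_if_neg_deriv_where_pos[where f = "\<lambda>t. u (s, t)" and f' = "\<lambda>t. d_tau u (s, t)"]
        admissible_continuous_sections admissible_deriv_snd admissible_nonneg u) auto
qed

lemma AE_not_if_unique:
  fixes P :: "real \<Rightarrow> bool"
  assumes "\<And>x y. P x \<Longrightarrow> P y \<Longrightarrow> x = y"
  shows "AE x in lborel. \<not> P x"
proof -
  have "Collect P \<subseteq> {SOME x. P x}" using assms by (auto intro: someI)
  then have "finite (Collect P)" by (rule finite_subset) simp
  then have "Collect P \<in> null_sets lborel" by (rule finite_imp_null_set_lborel)
  then show ?thesis using AE_not_in by force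
qed

text \<open>Where \<open>u = 0\<close>, each partial derivative vanishes except at the first zero on the respective
  line, which is one point per line; those points form a null set by Tonelli's theorem.\<close>

lemma AE_grad_eq_pos_grad:
  assumes u: "admissible u"
  shows "AE x in lborel. x \<in> pos_quadrant \<longrightarrow> grad u x = pos_grad u x"
proof -
  note [measurable] = admissible_measurable[OF u]
  define P where "P s t \<longleftrightarrow> \<not> (0 < t \<and> first_zero (\<lambda>s. u (s, t)) s)" for s t
  define Q where "Q s t \<longleftrightarrow> \<not> (0 < s \<and> first_zero (\<lambda>t. u (s, t)) t)" for s t
  have mP: "{x \<in> space (lborel \<Otimes>\<^sub>M lborel). P (fst x) (snd x)} \<in> sets (lborel \<Otimes>\<^sub>M lborel)"
    unfolding P_def first_zero_def by measurable
  have mQ: "{x \<in> space (lborel \<Otimes>\<^sub>M lborel). Q (fst x) (snd x)} \<in> sets (lborel \<Otimes>\<^sub>M lborel)"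
    unfolding Q_def first_zero_def by measurable
  have "AE t in lborel. AE s in lborel. P s t"
    unfolding P_def
    by (intro always_eventually allI AE_not_if_unique)
      (auto intro!: first_zero_unique[where f = "\<lambda>s. u (s, _)"] admissible_decreasing(1)[OF u] admissible_nonneg[OF u])
  then have aeP: "AE x in lborel \<Otimes>\<^sub>M lborel. P (fst x) (snd x)"
    using lborel_pair.AE_commute[OF mP] lborel_pair.AE_pair_iff[OF mP] by simp
  have "AE s in lborel. AE t in lborel. Q s t"
    unfolding Q_def
    by (intro always_eventually allI AE_not_if_unique)
      (auto intro!: first_zero_unique[where f = "\<lambda>t. u (_, t)"] admissible_decreasing(2)[OF u] admissible_nonneg[OF u])
  then have aeQ: "AE x in lborel \<Otimes>\<^sub>M lborel. Q (fst x) (snd x)"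
    using lborel_pair.AE_pair_iff[OF mQ] by simp
  have "AE x in lborel \<Otimes>\<^sub>M lborel. x \<in> pos_quadrant \<longrightarrow> grad u x = pos_grad u x"
    using aeP aeQ
  proof eventually_elim
    case (elim x)
    show ?case
    proof
      assume x: "x \<in> pos_quadrant"
      show "grad u x = pos_grad u x"
      proof (cases "0 < u x")
        case True
        then show ?thesis using x by (simp add: pos_grad_def)
      next
        case False
        obtain s t where st: "x = (s, t)" "0 < s" "0 < t"
          using x by (auto simp: pos_quadrant_def)
        have u0: "u (s, t) = 0" using False admissible_nonneg[OF u, of x] st by simp
        have "deriv (\<lambda>s. u (s, t)) s = 0"
          using elim(1) st u0 admissible_decreasing(1)[OF u] admissible_nonneg[OF u]
          by (intro deriv_zero_after_first_zero) (auto simp: P_def)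
        moreover have "deriv (\<lambda>t. u (s, t)) t = 0"
          using elim(2) st u0 admissible_decreasing(2)[OF u] admissible_nonneg[OF u]
          by (intro deriv_zero_after_first_zero) (auto simp: Q_def)
        ultimately show ?thesis
          using False st by (simp add: pos_grad_def grad_def d_sigma_def d_tau_def zero_prod_def)
      qed
    qed
  qed
  then show ?thesis by (simp only: lborel_prod)
qed

lemma norm_pos_grad_bounded:
  assumes u: "admissible u"
  obtains M where "0 \<le> M" "\<And>x. norm (pos_grad u x) \<le> M"
proof -
  obtain L where L: "L-lipschitz_on UNIV u" using u by (auto simp: admissible_def)
  then have L0: "0 \<le> L" by (rule lipschitz_on_nonneg)
  have *: "\<bar>d\<bar> \<le> L" if d: "(f has_real_derivative d) (at x)" and f: "\<And>y. \<bar>f y - f x\<bar> \<le> L * \<bar>y - x\<bar>"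
    for f :: "real \<Rightarrow> real" and d x
  proof (rule tendsto_upperbound)
    show "((\<lambda>y. \<bar>(f y - f x) / (y - x)\<bar>) \<longlongrightarrow> \<bar>d\<bar>) (at x)"
      using d by (intro tendsto_rabs) (simp add: has_field_derivative_iff)
    show "\<forall>\<^sub>F y in at x. \<bar>(f y - f x) / (y - x)\<bar> \<le> L"
      unfolding eventually_at_filter
      by (intro always_eventually) (use f in \<open>auto simp: abs_divide pos_divide_le_eq\<close>)
  qed simp
  have "norm (pos_grad u x) \<le> 2 * L" for x
  proof (cases "x \<in> pos_quadrant \<and> 0 < u x")
    case True
    obtain s t where st: "x = (s, t)" "0 < s" "0 < t" using True by (auto simp: pos_quadrant_def)
    have "\<bar>d_sigma u x\<bar> \<le> L"
      using admissible_deriv_fst[OF u, of s t] True st lipschitz_onD[OF L, of "(_, t)" "(s, t)"]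
      by (intro *[of "\<lambda>s. u (s, t)" _ s]) (auto simp: dist_Pair_Pair dist_real_def)
    moreover have "\<bar>d_tau u x\<bar> \<le> L"
      using admissible_deriv_snd[OF u, of s t] True st lipschitz_onD[OF L, of "(s, _)" "(s, t)"]
      by (intro *[of "\<lambda>t. u (s, t)" _ t]) (auto simp: dist_Pair_Pair dist_real_def)
    ultimately show ?thesis
      using True norm_Pair_le[of "d_sigma u x" "d_tau u x"] by (simp add: pos_grad_def grad_def)
  qed (use L0 in \<open>auto simp: pos_grad_def\<close>)
  then show ?thesis using L0 by (intro that[of "2 * L"]) auto
qed

text \<open>The function \<open>f\<close> itself need not be Borel measurable; it only agrees with one that is, outside
  a null set, and completeness of the Lebesgue measure does the rest.\<close>

lemma set_lebesgue_integral_eq_quad_int: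
  assumes F: "(\<lambda>(s, t). F s t) \<in> borel_measurable (lborel \<Otimes>\<^sub>M lborel)" and nn: "\<And>s t. 0 \<le> F s t"
    and ae: "AE x in lborel. x \<in> pos_quadrant \<longrightarrow> f x = fst x powr a * snd x powr b * F (fst x) (snd x)"
  shows "(LINT x:pos_quadrant|lebesgue. f x) = enn2real (quad_int a b F)"
proof -
  note [measurable] = F
  define W where "W x = pw a (fst x) * pw b (snd x) * F (fst x) (snd x)" for x
  have "(\<lambda>x. F (fst x) (snd x)) \<in> borel_measurable (lborel \<Otimes>\<^sub>M lborel)"
    by measurable
  then have "W \<in> borel_measurable (lborel \<Otimes>\<^sub>M lborel)"
    unfolding W_def by measurable
  then have W: "W \<in> borel_measurable lborel" and Wb: "W \<in> borel_measurable (lborel \<Otimes>\<^sub>M lborel)"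
    by (simp_all add: lborel_prod)
  have ae': "AE x in lebesgue. W x = indicator pos_quadrant x *\<^sub>R f x"
    using AE_completion[OF ae]
    by eventually_elim (auto simp: W_def pw_def indicator_def pos_quadrant_def mem_Times_iff)
  have WL: "W \<in> borel_measurable lebesgue"
    using W by (rule measurable_completion)
  have "(LINT x:pos_quadrant|lebesgue. f x) = integral\<^sup>L lebesgue W"
    unfolding set_lebesgue_integral_def
    by (rule integral_cong_AE[symmetric, OF WL borel_measurable_AE[OF WL ae'] ae'])
  also have "\<dots> = integral\<^sup>L lborel W"
    using W by (rule integral_completion)
  also have "\<dots> = enn2real (\<integral>\<^sup>+x. ennreal (W x) \<partial>lborel)"
    using W nn by (intro integral_eq_nn_integral) (auto simp: W_def)
  also have "(\<integral>\<^sup>+x. ennreal (W x) \<partial>lborel) = (\<integral>\<^sup>+t. (\<integral>\<^sup>+s. ennreal (W (s, t)) \<partial>lborel) \<partial>lborel)"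
    using lborel_pair.nn_integral_snd[of "\<lambda>x. ennreal (W x)"] Wb by (simp add: lborel_prod)
  also have "\<dots> = quad_int a b F"
    by (simp add: quad_int_def W_def)
  finally show ?thesis .
qed

section \<open>The Sobolev inequality\<close>

theorem proposition1p7:
  fixes a b D q qs :: real
  assumes "a > -1" and "b > -1" and "a > 0 \<or> b > 0"
    and "D = 2 + a + b"
    and "1 \<le> q" and "q < D"
    and "qs = D * q / (D - q)"
  shows "\<exists>C::real. \<forall>u :: real \<times> real \<Rightarrow> real. admissible u \<longrightarrow>
    (LINT x:pos_quadrant|lebesgue. fst x powr a * snd x powr b * \<bar>u x\<bar> powr qs) powr (1 / qs)
    \<le> C * (LINT x:pos_quadrant|lebesgue. fst x powr a * snd x powr b * norm (grad u x) powr q) powr (1 / q)"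
proof -
  define p where "p = 1 + a + b"
  define e where "e = (p + 1) / p"
  \<comment> \<open>chosen such that \<open>k * e\<close> and, for \<open>q > 1\<close>, \<open>(k - 1) * (q / (q - 1))\<close> both equal \<open>qs\<close>\<close>
  define k where "k = q * p / (D - q)"
  have p0: "0 < p" and Dp: "D = p + 1" and D0: "0 < D" "0 < D - q" and q0: "0 < q"
    using assms by (auto simp: p_def)
  have k0: "0 < k" and e0: "0 < e" and qs0: "0 < qs"
    using p0 D0 q0 assms(7) by (simp_all add: k_def e_def)
  have keq: "k * e = qs"
    using p0 D0 unfolding assms(7) k_def e_def Dp by simp
  have exps: "1 / e - (1 - 1 / q) = 1 / qs"
    using p0 D0 q0 unfolding assms(7) e_def Dp by (simp add: field_simps)
  obtain M where M: "M > 0" and sob: "\<And>v g h K. tail_density v g \<Longrightarrow>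
    tail_density (\<lambda>t s. v s t) (\<lambda>t s. h s t) \<Longrightarrow> 0 \<le> K \<Longrightarrow>
    quad_int a b g \<le> ennreal K \<Longrightarrow> quad_int a b h \<le> ennreal K \<Longrightarrow>
    quad_int a b (\<lambda>s t. v s t powr e) \<le> ennreal (M * K powr e)"
    using sobolev_exponent_one[OF assms(1-3) p_def] unfolding e_def by blast
  define C where "C = M powr (1 / e) * k"
  have C0: "0 < C" using M k0 by (simp add: C_def)
  show ?thesis
  proof (intro exI[of _ C] allI impI)
    fix u :: "real \<times> real \<Rightarrow> real"
    assume u: "admissible u"
    note [measurable] = admissible_measurable[OF u] pos_grad_components_measurable[OF u]
    have nn: "0 \<le> u x" for x by (rule admissible_nonneg[OF u])
    define N where "N s t = norm (pos_grad u (s, t))" for s t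
    have mN [measurable]: "(\<lambda>(s, t). N s t) \<in> borel_measurable (lborel \<Otimes>\<^sub>M lborel)"
      unfolding N_def by measurable
    have N0: "0 \<le> N s t" for s t by (simp add: N_def)
    define Y where "Y = enn2real (quad_int a b (\<lambda>s t. u (s, t) powr qs))"
    define X where "X = enn2real (quad_int a b (\<lambda>s t. N s t powr q))"
    have Y0: "0 \<le> Y" and X0: "0 \<le> X" by (simp_all add: Y_def X_def)
    have intY: "(LINT x:pos_quadrant|lebesgue. fst x powr a * snd x powr b * \<bar>u x\<bar> powr qs) = Y"
      unfolding Y_def using nn by (intro set_lebesgue_integral_eq_quad_int) (auto, measurable)
    have intX: "(LINT x:pos_quadrant|lebesgue. fst x powr a * snd x powr b * norm (grad u x) powr q) = X"
      unfolding X_def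
    proof (rule set_lebesgue_integral_eq_quad_int)
      show "AE x in lborel. x \<in> pos_quadrant \<longrightarrow> fst x powr a * snd x powr b * norm (grad u x) powr q
          = fst x powr a * snd x powr b * N (fst x) (snd x) powr q"
        using AE_grad_eq_pos_grad[OF u] by eventually_elim (simp add: N_def)
    qed simp_all
    obtain R where R: "0 < R" "\<And>s t. R \<le> s \<or> R \<le> t \<Longrightarrow> u (s, t) = 0"
      using admissible_support[OF u] by metis
    obtain L where L: "0 \<le> L" "\<And>x. norm (pos_grad u x) \<le> L"
      using norm_pos_grad_bounded[OF u] by metis
    obtain B where B: "\<And>x. u x \<le> B"
      using admissible_bounded[OF u] by metis
    have B0: "0 \<le> B"
      using B[of 0] nn[of 0] by simp
    have finY: "quad_int a b (\<lambda>s t. u (s, t) powr qs) = ennreal Y"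
    proof -
      have "quad_int a b (\<lambda>s t. u (s, t) powr qs) < \<infinity>"
        using R B B0 nn qs0 assms(1,2)
        by (intro quad_int_finite[where R = R and M = "B powr qs"] powr_mono2) auto
      then show ?thesis by (simp add: Y_def)
    qed
    have finX: "quad_int a b (\<lambda>s t. N s t powr q) = ennreal X"
    proof -
      have "quad_int a b (\<lambda>s t. N s t powr q) < \<infinity>"
        using R L q0 assms(1,2)
        by (intro quad_int_finite[where R = R and M = "L powr q"] powr_mono2) (auto simp: N_def pos_grad_def)
      then show ?thesis by (simp add: X_def)
    qed
    \<comment> \<open>\<open>X'\<close> instead of \<open>X\<close> allows dividing by it in Hoelder's inequality when \<open>X = 0\<close>\<close>
    have main: "Y powr (1 / qs) \<le> C * X' powr (1 / q)" if X': "X \<le> X'" "0 < X'" for X'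
    proof (cases "Y = 0")
      case True
      then show ?thesis using C0 by simp
    next
      case False
      then have Ypos: "0 < Y" using Y0 by simp
      define K where "K = k * (X' powr (1 / q) * Y powr (1 - 1 / q))"
      have K0: "0 \<le> K" using k0 by (simp add: K_def)
      have holder: "quad_int a b (\<lambda>s t. k * (N s t * u (s, t) powr (k - 1))) \<le> ennreal K"
      \<comment> \<open>for \<open>q = 1\<close> the conjugate exponent is infinite, but then \<open>k = 1\<close> and the bound is immediate\<close>
      proof (cases "q = 1")
        case True
        then have "k = 1" using D0 by (simp add: k_def Dp)
        then have "quad_int a b (\<lambda>s t. k * (N s t * u (s, t) powr (k - 1)))
            \<le> quad_int a b (\<lambda>s t. N s t powr q)"
          using True N0 by (intro quad_int_mono mult_left_mono) auto
        also have "\<dots> \<le> ennreal K"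
          using finX X' Ypos True \<open>k = 1\<close> by (simp add: K_def ennreal_leI)
        finally show ?thesis .
      next
        case False
        then have q1: "1 < q" using assms(5) by simp
        define q' where "q' = q / (q - 1)"
        have q': "1 < q'" "1 / q + 1 / q' = 1" "1 / q' = 1 - 1 / q"
          using q1 by (auto simp: q'_def field_simps)
        have "k - 1 = D * (q - 1) / (D - q)"
          using D0 by (simp add: k_def Dp field_simps)
        then have kq: "(k - 1) * q' = qs"
          using q1 by (simp add: q'_def assms(7))
        have "quad_int a b (\<lambda>s t. k * (N s t * u (s, t) powr (k - 1)))
          = ennreal k * quad_int a b (\<lambda>s t. N s t * u (s, t) powr (k - 1))"
          using k0 by (intro quad_int_cmult) auto
        also have "\<dots> \<le> ennreal k * ennreal (X' powr (1 / q) * Y powr (1 / q'))"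
        proof (intro mult_left_mono quad_int_Holder N0 q1 q' X' Ypos)
          show "quad_int a b (\<lambda>s t. N s t powr q) \<le> ennreal X'"
            using finX X' by (simp add: ennreal_leI)
          have "(u (s, t) powr (k - 1)) powr q' = u (s, t) powr qs" for s t
            by (simp add: powr_powr kq)
          then show "quad_int a b (\<lambda>s t. (u (s, t) powr (k - 1)) powr q') \<le> ennreal Y"
            using finY by simp
        qed auto
        also have "\<dots> = ennreal K"
          using k0 by (simp add: K_def q' flip: ennreal_mult)
        finally show ?thesis .
      qed
      have comp: "- fst x \<le> norm x" "- snd x \<le> norm x" for x :: "real \<times> real"
        using norm_fst_le[of "fst x" "snd x"] norm_snd_le[of "snd x" "fst x"] by auto
      have weight: "pw a s * pw b t * (k * u (s, t) powr (k - 1) * c)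
          \<le> pw a s * pw b t * (k * (N s t * u (s, t) powr (k - 1)))" if "c \<le> N s t" for c s t
      proof -
        have "k * u (s, t) powr (k - 1) * c \<le> k * u (s, t) powr (k - 1) * N s t"
          using that k0 by (intro mult_left_mono) auto
        then show ?thesis
          by (intro mult_left_mono) (simp_all add: mult_ac)
      qed
      have A: "quad_int a b (\<lambda>s t. k * u (s, t) powr (k - 1) * - fst (pos_grad u (s, t))) \<le> ennreal K"
        by (rule order_trans[OF quad_int_mono holder], rule weight) (simp only: N_def comp)
      have B: "quad_int a b (\<lambda>s t. k * u (s, t) powr (k - 1) * - snd (pos_grad u (s, t))) \<le> ennreal K"
        by (rule order_trans[OF quad_int_mono holder], rule weight) (simp only: N_def comp)
      have "ennreal Y = quad_int a b (\<lambda>s t. (u (s, t) powr k) powr e)"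
        using finY by (simp add: powr_powr keq)
      also have "\<dots> \<le> ennreal (M * K powr e)"
        using sob[OF tail_density_admissible_fst[OF u k0] tail_density_admissible_snd[OF u k0] K0 A B] .
      finally have "Y \<le> M * K powr e"
        using M by simp
      then have "Y powr (1 / e) \<le> (M * K powr e) powr (1 / e)"
        using e0 Y0 by (intro powr_mono2) auto
      also have "\<dots> = M powr (1 / e) * K"
        using M K0 e0 by (simp add: powr_mult powr_powr)
      \<comment> \<open>\<open>Y\<close> is finite, so that its power on the right can be absorbed\<close>
      finally have "Y powr (1 / e) \<le> C * X' powr (1 / q) * Y powr (1 - 1 / q)"
        by (simp add: C_def K_def mult_ac)
      then have "Y powr (1 / e) / Y powr (1 - 1 / q) \<le> C * X' powr (1 / q)"
        using Ypos by (simp add: pos_divide_le_eq)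
      then show ?thesis
        using Ypos by (simp only: powr_diff[symmetric] exps)
    qed
    have "Y powr (1 / qs) \<le> C * X powr (1 / q)"
    proof (cases "X = 0")
      case False
      then show ?thesis using main[of X] X0 by simp
    next
      case True
      have "Y powr (1 / qs) \<le> 0 + \<epsilon>" if "0 < \<epsilon>" for \<epsilon>
        using main[of "(\<epsilon> / C) powr q"] True that C0 q0 by (simp add: powr_powr)
      then have "Y powr (1 / qs) \<le> 0" by (rule field_le_epsilon)
      then show ?thesis using True by simp
    qed
    then show "(LINT x:pos_quadrant|lebesgue. fst x powr a * snd x powr b * \<bar>u x\<bar> powr qs) powr (1 / qs)
      \<le> C * (LINT x:pos_quadrant|lebesgue. fst x powr a * snd x powr b * norm (grad u x) powr q) powr (1 / q)"
      by (simp only: intX intY)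
  qed
qed

end
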